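(* Let $\mu,\nu\in\mathrm{M}_0(\mathbb{R}^d)$ and $\gamma\in\Gamma_{0,\mathrm{cm}}(\mu,\nu)$, and assume that $\mu$ vanishes on sets of Hausdorff dimension at most $d-1$. Then for any closed convex function $\psi:\mathbb{R}^d\to\mathbb{R}\cup\{\infty\}$ satisfying $\mathrm{spt}\,\gamma\subset\partial\psi$, we have $\mu\big((\mathbb{R}^d\setminus\{0\})\setminus\mathrm{dom}\,\nabla\psi\big)=0$. For every Borel set $B\subset\mathbb{R}^d\setminus\{0\}$, $$\nu(B)=(\nabla\psi)_{\#}\mu(B)+\gamma(\{0\}\times B).$$ In addition, $\gamma$ is uniquely determined by $\nabla\psi,\mu,\nu$ through the identities $$\gamma(A\times B)=(\mathrm{Id}\times\nabla\psi)_{\#}\mu(A\times B)=\mu\big(A\cap(\nabla\psi)^{-1}(B)\big)$$ for all Borel $A\subset\mathbb{R}^d\setminus\{0\}$ and $B\subset\mathbb{R}^d$, and $$\gamma(\{0\}\times B)=\nu(B)-(\nabla\psi)_{\#}\mu(B)$$ for all Borel $B\subset\mathbb{R}^d$ with $0\notin\mathrm{cl}(B)$. Finally, if $\gamma$ is proper, then $$\gamma=\mathrm{res}\big((\mathrm{Id}\times\nabla\psi)_{\#}\mu\big)\quad\text{and}\quad\nu=\mathrm{res}\big((\nabla\psi)_{\#}\mu\big).$$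
   Context: $\mathrm{M}_0(\mathbb{R}^k)$ denotes the set of nonnegative Borel measures $\mu$ on $\mathbb{R}^k\setminus\{0\}$ such that $\mu(B)<\infty$ for every Borel set $B\subset\mathbb{R}^k\setminus\{0\}$ with $0\notin \mathrm{cl}(B)$ (closure in $\mathbb{R}^k$). The support $\mathrm{spt}\,\mu$ is the set of $x\in\mathbb{R}^k$ such that $\mu(U\setminus\{0\})>0$ for every open $U\subset\mathbb{R}^k$ containing $x$ (so $0$ may belong to $\mathrm{spt}\,\mu$). "$\mu$ vanishes on sets of Hausdorff dimension at most $d-1$" means $\mu(A)=0$ for every Borel $A\subset\mathbb{R}^d\setminus\{0\}$ of Hausdorff dimension at most $d-1$. For $\mu,\nu\in\mathrm{M}_0(\mathbb{R}^d)$, a zero-coupling between $\mu$ and $\nu$ is a nonnegative Borel measure $\gamma$ on $(\mathbb{R}^d\times\mathbb{R}^d)\setminus\{(0,0)\}$ such that $\gamma(A\times\mathbb{R}^d)=\mu(A)$ and $\gamma(\mathbb{R}^d\times A)=\nu(A)$ for all Borel $A\subset\mathbb{R}^d\setminus\{0\}$; any such $\gamma$ belongs to $\mathrm{M}_0(\mathbb{R}^d\times\mathbb{R}^d)=\mathrm{M}_0(\mathbb{R}^{2d})$. $\Gamma_{0,\mathrm{cm}}(\mu,\nu)$ is the set of zero-couplings $\gamma$ such that $\mathrm{spt}\,\gamma$ is cyclically monotone. A set $T\subset\mathbb{R}^d\times\mathbb{R}^d$ is cyclically monotone if for every integer $n\ge 2$ and all $(x_1,y_1),\dots,(x_n,y_n)\in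 T$, with $y_{n+1}:=y_1$, one has $\sum_{i=1}^n\langle x_i,y_i\rangle\ge\sum_{i=1}^n\langle x_i,y_{i+1}\rangle$. A zero-coupling $\gamma$ is proper if $\gamma(\{0\}\times(\mathbb{R}^d\setminus\{0\}))=0$. A convex function $\psi:\mathbb{R}^d\to\mathbb{R}\cup\{\infty\}$ is closed if its epigraph is closed (equivalently, $\psi$ is lower semicontinuous); $\mathrm{dom}\,\psi=\{\psi<\infty\}$; $\partial\psi=\{(x,v)\in\mathrm{dom}\,\psi\times\mathbb{R}^d:\forall y\in\mathbb{R}^d,\ \psi(y)\ge\psi(x)+\langle y-x,v\rangle\}$; $\mathrm{dom}\,\nabla\psi$ is the set of points where $\psi$ is (finite and) differentiable, and $(\nabla\psi)^{-1}(B)=\{x\in\mathrm{dom}\,\nabla\psi:\nabla\psi(x)\in B\}$. For $\mu$ a measure on $\mathbb{R}^d\setminus\{0\}$, $(\nabla\psi)_{\#}\mu$ is the Borel measure on $\mathbb{R}^d$ given by $(\nabla\psi)_{\#}\mu(B)=\mu\big((\nabla\psi)^{-1}(B)\setminus\{0\}\big)$, and $(\mathrm{Id}\times\nabla\psi)_{\#}\mu$ is the push-forward measure on $\mathbb{R}^d\times\mathbb{R}^d$ of $\mu$ by the map $x\mapsto(x,\nabla\psi(x))$ defined on $\mathrm{dom}\,\nabla\psi\setminus\{0\}$. For a Borel measure $m$ on $\mathbb{R}^k$, $\mathrm{res}\,m$ is its restriction to $\mathbb{R}^k\setminus\{0\}$. *)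

theory Defs
  imports "HOL-Analysis.Analysis"
begin

section \<open>Hausdorff dimension\<close>

text \<open>The case distinction implements the conventions $0^0 = 1$ for nonempty sets and
  cost $0$ for the empty set; note that \<^term>\<open>0 powr 0 = (0::real)\<close>.\<close>

definition hausdorff_cost :: "real \<Rightarrow> 'a::metric_space set \<Rightarrow> ennreal" where
  "hausdorff_cost s U =
     (if U = {} then 0 else if s = 0 then 1 else ennreal (diameter U powr s))"

text \<open>Boundedness is required explicitly because \<^const>\<open>diameter\<close> is real-valued and hence
  meaningless on unbounded sets.\<close>

definition hausdorff_premeasure :: "real \<Rightarrow> real \<Rightarrow> 'a::metric_space set \<Rightarrow> ennreal" where
  "hausdorff_premeasure s \<delta> A =
     (INF U \<in> {U :: nat \<Rightarrow> 'a set. A \<subseteq> (\<Union>i. U i) \<and>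
                  (\<forall>i. bounded (U i) \<and> diameter (U i) \<le> \<delta>)}.
        \<Sum>i. hausdorff_cost s (U i))"

definition hausdorff_measure :: "real \<Rightarrow> 'a::metric_space set \<Rightarrow> ennreal" where
  "hausdorff_measure s A = (SUP \<delta>\<in>{0<..}. hausdorff_premeasure s \<delta> A)"

definition hausdorff_dim :: "'a::metric_space set \<Rightarrow> ereal" where
  "hausdorff_dim A = Inf (ereal ` {s. 0 \<le> s \<and> hausdorff_measure s A = 0})"


section \<open>Measures on the punctured space, supports and zero-couplings\<close>

definition punctured_borel :: "'a::{topological_space, zero} measure" where
  "punctured_borel = restrict_space borel (UNIV - {0})"

definition M0 :: "'a::{topological_space, zero} measure set" where
  "M0 = {\<mu>. sets \<mu> = sets punctured_borel \<and>
             (\<forall>B \<in> sets punctured_borel. 0 \<notin> closure B \<longrightarrow> emeasure \<mu> B < \<infinity>)}"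

text \<open>The support is a subset of the whole space; it may contain the origin.\<close>

definition spt :: "'a::{topological_space, zero} measure \<Rightarrow> 'a set" where
  "spt \<mu> = {x. \<forall>U. open U \<longrightarrow> x \<in> U \<longrightarrow> emeasure \<mu> (U - {0}) > 0}"

definition res :: "'a::{topological_space, zero} measure \<Rightarrow> 'a measure" where
  "res m = restrict_space m (UNIV - {0})"

definition zero_coupling ::
    "'a::euclidean_space measure \<Rightarrow> 'a measure \<Rightarrow> ('a \<times> 'a) measure \<Rightarrow> bool" where
  "zero_coupling \<mu> \<nu> \<gamma> \<longleftrightarrow>
     sets \<gamma> = sets punctured_borel \<and>
     (\<forall>A \<in> sets punctured_borel.
        emeasure \<gamma> (A \<times> UNIV) = emeasure \<mu> A \<and> emeasure \<gamma> (UNIV \<times> A) = emeasure \<nu> A)"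

definition proper_zero_coupling :: "('a::euclidean_space \<times> 'a) measure \<Rightarrow> bool" where
  "proper_zero_coupling \<gamma> \<longleftrightarrow> emeasure \<gamma> ({0} \<times> (UNIV - {0})) = 0"

text \<open>The pairs are indexed by $0, \dots, n-1$, cyclically.\<close>

definition cyclically_monotone :: "('a::real_inner \<times> 'a) set \<Rightarrow> bool" where
  "cyclically_monotone T \<longleftrightarrow>
     (\<forall>n \<ge> 2. \<forall>(x :: nat \<Rightarrow> 'a) (y :: nat \<Rightarrow> 'a). (\<forall>i<n. (x i, y i) \<in> T) \<longrightarrow>
        (\<Sum>i<n. x i \<bullet> y i) \<ge> (\<Sum>i<n. x i \<bullet> y (Suc i mod n)))"

definition Gamma0_cm ::
    "'a::euclidean_space measure \<Rightarrow> 'a measure \<Rightarrow> ('a \<times> 'a) measure set" where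
  "Gamma0_cm \<mu> \<nu> = {\<gamma>. zero_coupling \<mu> \<nu> \<gamma> \<and> cyclically_monotone (spt \<gamma>)}"


section \<open>Extended-real-valued closed convex functions\<close>

definition closed_convex_fun :: "('a::euclidean_space \<Rightarrow> ereal) \<Rightarrow> bool" where
  "closed_convex_fun \<psi> \<longleftrightarrow>
     (\<forall>x. \<psi> x \<noteq> -\<infinity>) \<and>
     (\<forall>x y t. 0 < t \<and> t < 1 \<longrightarrow>
        \<psi> ((1 - t) *\<^sub>R x + t *\<^sub>R y) \<le> ereal (1 - t) * \<psi> x + ereal t * \<psi> y) \<and>
     closed {(x, r :: real). \<psi> x \<le> ereal r}"

definition edom :: "('a \<Rightarrow> ereal) \<Rightarrow> 'a set" where
  "edom \<psi> = {x. \<psi> x < \<infinity>}"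

definition subdiff :: "('a::real_inner \<Rightarrow> ereal) \<Rightarrow> ('a \<times> 'a) set" where
  "subdiff \<psi> = {(x, v). x \<in> edom \<psi> \<and> (\<forall>y. \<psi> y \<ge> \<psi> x + ereal ((y - x) \<bullet> v))}"

text \<open>Differentiability at a point presupposes finiteness in a neighbourhood, which has to be
  demanded explicitly because \<^const>\<open>real_of_ereal\<close> sends \<^term>\<open>\<infinity> :: ereal\<close> to $0$.\<close>

definition has_gradient :: "('a::euclidean_space \<Rightarrow> ereal) \<Rightarrow> 'a \<Rightarrow> 'a \<Rightarrow> bool" where
  "has_gradient \<psi> x v \<longleftrightarrow>
     x \<in> interior (edom \<psi>) \<and> GDERIV (\<lambda>y. real_of_ereal (\<psi> y)) x :> v"

definition dom_grad :: "('a::euclidean_space \<Rightarrow> ereal) \<Rightarrow> 'a set" where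
  "dom_grad \<psi> = {x. \<exists>v. has_gradient \<psi> x v}"

definition grad :: "('a::euclidean_space \<Rightarrow> ereal) \<Rightarrow> 'a \<Rightarrow> 'a" where
  "grad \<psi> x = (THE v. has_gradient \<psi> x v)"

definition grad_vimage :: "('a::euclidean_space \<Rightarrow> ereal) \<Rightarrow> 'a set \<Rightarrow> 'a set" where
  "grad_vimage \<psi> B = {x \<in> dom_grad \<psi>. grad \<psi> x \<in> B}"

text \<open>Since a measure on the punctured space has \<^term>\<open>UNIV - {0}\<close> as its space, the restrictions
  below live on \<^term>\<open>dom_grad \<psi> - {0}\<close>.\<close>

definition grad_push ::
    "('a::euclidean_space \<Rightarrow> ereal) \<Rightarrow> 'a measure \<Rightarrow> 'a measure" where
  "grad_push \<psi> \<mu> = distr (restrict_space \<mu> (dom_grad \<psi>)) borel (grad \<psi>)"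

definition id_grad_push ::
    "('a::euclidean_space \<Rightarrow> ereal) \<Rightarrow> 'a measure \<Rightarrow> ('a \<times> 'a) measure" where
  "id_grad_push \<psi> \<mu> =
     distr (restrict_space \<mu> (dom_grad \<psi>)) borel (\<lambda>x. (x, grad \<psi> x))"

end

theory Submission
  imports Defs
begin

text \<open>
  The whole statement rests on two facts about the graph $S = \partial\psi$ of the
  subdifferential. First, $\psi$ is differentiable at $x$ exactly when $S$ has a single point
  above $x$ (\<open>dom_grad_iff\<close>). Second, the points with several subgradients form a set of
  Hausdorff dimension at most $d-1$ (\<open>hausdorff_dim_subdiff_multivalued\<close>).

  The second fact follows from the parametrisation of a monotone graph by $z = x + v$:
  monotonicity makes $z \mapsto x$ nonexpansive. If there are two subgradients at $x$ then, the
  subdifferential being convex, the values $z$ above $x$ contain a nondegenerate segment, which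
  crosses some hyperplane $z_b = q$ with $q$ rational. So the multivalued points are covered by
  countably many nonexpansive images of pieces of hyperplanes, and these have $s$-dimensional
  measure zero for every $s > d - 1$.

  The coupling $\gamma$ is concentrated on its support, hence on $S$. Projecting to the first
  factor, $\mu$ is concentrated on the points having a subgradient, and since it does not charge
  the multivalued ones it is concentrated on $\mathrm{dom}\,\nabla\psi$
  (\<open>null_compl_dom_grad\<close>). Above such points $S$ is the graph of $\nabla\psi$, so up to a
  $\gamma$-null set $A \times B$ coincides with
  $(A \cap (\nabla\psi)^{-1}(B)) \times \mathbb{R}^d$, whose measure the first marginal
  prescribes (\<open>coupling_Times_eq\<close>). Splitting $\mathbb{R}^d \times B$ along
  $x = 0$ turns this into the formula for $\nu$. The sets $A \times B$ with $0 \notin A$ together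
  with the sets $\{0\} \times B$ with $0 \notin \mathrm{cl}(B)$ are a generator stable under
  intersection on which $\gamma$ is $\sigma$-finite (\<open>punctured_product_measure_eqI\<close>);
  this gives uniqueness, and the proper case is uniqueness applied to
  $\mathrm{res}((\mathrm{Id}\times\nabla\psi)_{\#}\mu)$.
\<close>

section \<open>Sets of vanishing Hausdorff measure\<close>

lemma hausdorff_premeasure_mono:
  assumes "A \<subseteq> B"
  shows "hausdorff_premeasure s \<delta> A \<le> hausdorff_premeasure s \<delta> B"
  unfolding hausdorff_premeasure_def using assms by (intro INF_superset_mono) auto

text \<open>Cover the $k$-th set at cost below $e/2^{k+1}$ and enumerate the double sequence of covering
  sets by a pairing of the naturals.\<close>

lemma hausdorff_premeasure_UN_null:
  fixes A :: "nat \<Rightarrow> 'a::metric_space set"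
  assumes null: "\<And>k. hausdorff_premeasure s \<delta> (A k) = 0"
  shows "hausdorff_premeasure s \<delta> (\<Union>k. A k) = 0"
proof -
  have "hausdorff_premeasure s \<delta> (\<Union>k. A k) \<le> 0 + ennreal e" if "0 < e" for e :: real
  proof -
    define \<epsilon> where "\<epsilon> k = ennreal (e * (1/2) ^ Suc k)" for k
    have pos: "\<epsilon> k > 0" for k
      unfolding \<epsilon>_def using that by simp
    have "\<exists>U. A k \<subseteq> (\<Union>i. U i) \<and> (\<forall>i. bounded (U i) \<and> diameter (U i) \<le> \<delta>) \<and>
              (\<Sum>i. hausdorff_cost s (U i)) < \<epsilon> k" for k
    proof -
      have "hausdorff_premeasure s \<delta> (A k) < \<epsilon> k" using null pos by simp
      then show ?thesis
        unfolding hausdorff_premeasure_def INF_less_iff by blast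
    qed
    then obtain U where U: "\<And>k. A k \<subseteq> (\<Union>i. U k i)"
        "\<And>k i. bounded (U k i)" "\<And>k i. diameter (U k i) \<le> \<delta>"
        "\<And>k. (\<Sum>i. hausdorff_cost s (U k i)) < \<epsilon> k"
      by metis
    define V where "V n = (case prod_decode n of (k, i) \<Rightarrow> U k i)" for n
    have "(\<Union>k. A k) \<subseteq> (\<Union>n. V n)"
    proof
      fix x assume "x \<in> (\<Union>k. A k)"
      then obtain k i where "x \<in> U k i" using U(1) by blast
      then have "x \<in> V (prod_encode (k, i))" by (simp add: V_def)
      then show "x \<in> (\<Union>n. V n)" by blast
    qed
    then have "hausdorff_premeasure s \<delta> (\<Union>k. A k) \<le> (\<Sum>n. hausdorff_cost s (V n))"
      unfolding hausdorff_premeasure_def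
      by (intro INF_lower) (auto simp: V_def U split: prod.split)
    also have "\<dots> = (\<Sum>k. \<Sum>i. hausdorff_cost s (U k i))"
      by (subst suminf_ennreal_2dimen[where f = "\<lambda>(k, i). hausdorff_cost s (U k i)", symmetric])
         (auto simp: V_def split: prod.split intro!: suminf_cong)
    also have "\<dots> \<le> (\<Sum>k. \<epsilon> k)"
      using U(4) by (intro suminf_le) (auto intro: less_imp_le)
    also have "\<dots> = ennreal e"
    proof -
      have "(\<lambda>k. e * (1/2) ^ Suc k) sums (e * 1)"
        by (rule sums_mult[OF power_half_series])
      then show ?thesis
        unfolding \<epsilon>_def using that by (intro suminf_ennreal_eq) simp_all
    qed
    finally show ?thesis by simp
  qed
  then have "hausdorff_premeasure s \<delta> (\<Union>k. A k) \<le> 0"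
    by (rule ennreal_le_epsilon)
  then show ?thesis by simp
qed

lemma hausdorff_measure_eq_0_iff:
  "hausdorff_measure s A = 0 \<longleftrightarrow> (\<forall>\<delta>>0. hausdorff_premeasure s \<delta> A = 0)"
proof -
  have "hausdorff_measure s A \<le> 0 \<longleftrightarrow> (\<forall>\<delta>>0. hausdorff_premeasure s \<delta> A \<le> 0)"
    unfolding hausdorff_measure_def by (subst SUP_le_iff) auto
  then show ?thesis by simp
qed

lemma hausdorff_measure_countable_UN_null:
  fixes A :: "'i \<Rightarrow> 'a::metric_space set"
  assumes "countable I" "\<And>i. i \<in> I \<Longrightarrow> hausdorff_measure s (A i) = 0"
    and "B \<subseteq> (\<Union>i\<in>I. A i)" "s > 0"
  shows "hausdorff_measure s B = 0"
proof (cases "I = {}")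
  case True
  have "hausdorff_premeasure s \<delta> B = 0" if "\<delta> > 0" for \<delta>
  proof -
    have "hausdorff_premeasure s \<delta> B \<le> (\<Sum>i::nat. hausdorff_cost s ({} :: 'a set))"
      unfolding hausdorff_premeasure_def using that assms True
      by (intro INF_lower) auto
    then show ?thesis by (simp add: hausdorff_cost_def)
  qed
  then show ?thesis by (simp add: hausdorff_measure_eq_0_iff)
next
  case False
  have "hausdorff_premeasure s \<delta> B = 0" if "\<delta> > 0" for \<delta>
  proof -
    have "B \<subseteq> (\<Union>k. A (from_nat_into I k))"
      using assms(1,3) False by (auto simp: subset_iff) (metis from_nat_into_surj)
    then have "hausdorff_premeasure s \<delta> B \<le> hausdorff_premeasure s \<delta> (\<Union>k. A (from_nat_into I k))"
      by (rule hausdorff_premeasure_mono)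
    also have "\<dots> = 0"
      using assms(2) that False
      by (intro hausdorff_premeasure_UN_null) (auto simp: hausdorff_measure_eq_0_iff from_nat_into)
    finally show ?thesis by simp
  qed
  then show ?thesis by (simp add: hausdorff_measure_eq_0_iff)
qed

text \<open>Empty sets, which cost nothing, extend the finite cover to a sequence. The bound is on
  distances inside each piece, which yields boundedness and the diameter bound at once.\<close>

lemma hausdorff_premeasure_finite_cover:
  fixes U :: "'i \<Rightarrow> 'a::metric_space set"
  assumes "finite I" "A \<subseteq> (\<Union>i\<in>I. U i)" "s > 0" "\<eta> \<le> \<delta>" "0 \<le> \<eta>"
    and small: "\<And>i x y. i \<in> I \<Longrightarrow> x \<in> U i \<Longrightarrow> y \<in> U i \<Longrightarrow> dist x y \<le> \<eta>"
  shows "hausdorff_premeasure s \<delta> A \<le> ennreal (real (card I) * \<eta> powr s)"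
proof -
  obtain h where h: "bij_betw h {..<card I} I"
    using assms(1) ex_bij_betw_nat_finite[of I] by (auto simp: atLeast0LessThan)
  define V where "V n = (if n < card I then U (h n) else {})" for n
  have V: "dist x y \<le> \<eta>" if "x \<in> V n" "y \<in> V n" for n x y
    using that small[of "h n" x y] h by (auto simp: V_def bij_betw_def split: if_splits)
  have bdd: "bounded (V n)" for n
    by (cases "V n = {}") (auto simp: bounded_def intro!: V)
  have diam: "diameter (V n) \<le> \<eta>" for n
  proof (cases "V n = {}")
    case False
    then show ?thesis unfolding diameter_def using V[of _ n]
      by (auto intro!: cSUP_least)
  qed (simp add: assms(5))
  have "A \<subseteq> (\<Union>n. V n)"
  proof
    fix x assume "x \<in> A"
    then obtain i where i: "i \<in> I" "x \<in> U i" using assms(2) by blast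
    then obtain n where "n < card I" "h n = i"
      using h unfolding bij_betw_def by (metis imageE lessThan_iff)
    then have "x \<in> V n" using i by (simp add: V_def)
    then show "x \<in> (\<Union>n. V n)" by blast
  qed
  then have "hausdorff_premeasure s \<delta> A \<le> (\<Sum>n. hausdorff_cost s (V n))"
    unfolding hausdorff_premeasure_def
    by (intro INF_lower) (use bdd diam assms(4) in \<open>auto intro: order_trans\<close>)
  also have "\<dots> = (\<Sum>n<card I. hausdorff_cost s (V n))"
    by (intro suminf_finite) (auto simp: V_def hausdorff_cost_def)
  also have "\<dots> \<le> (\<Sum>n<card I. ennreal (\<eta> powr s))"
    using diam bdd assms(3)
    by (intro sum_mono) (auto simp: hausdorff_cost_def diameter_ge_0 intro!: ennreal_leI powr_mono2)
  also have "\<dots> = ennreal (real (card I) * \<eta> powr s)"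
    by (simp add: ennreal_mult' ennreal_of_nat_eq_real_of_nat)
  finally show ?thesis .
qed

text \<open>A bounded piece of a hyperplane meets at most $(2LN+1)^{d-1}$ cells of the grid of mesh $1/N$,
  and a cell has diameter at most $(d-1)/N$ because one coordinate is constant. Nonexpansive images
  inherit this, so the cost is at most $(2LN+1)^{d-1}((d-1)/N)^s$, which tends to $0$ for
  $s > d-1$. The map is given implicitly, as $g(p) \<mapsto> f(p)$, so that a relation such as
  the inverse of $x \<mapsto> x + \partial\psi(x)$ can be used without choosing values.\<close>

lemma hausdorff_measure_nonexpansive_hyperplane:
  fixes f :: "'c \<Rightarrow> 'b::metric_space" and g :: "'c \<Rightarrow> 'a::euclidean_space"
  assumes b0: "b0 \<in> Basis" and plane: "\<And>p. p \<in> S \<Longrightarrow> g p \<bullet> b0 = q"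
    and bdd: "\<And>p. p \<in> S \<Longrightarrow> norm (g p) \<le> real L"
    and lip: "\<And>p p'. p \<in> S \<Longrightarrow> p' \<in> S \<Longrightarrow> dist (f p) (f p') \<le> dist (g p) (g p')"
    and s: "s > real DIM('a) - 1"
  shows "hausdorff_measure s (f ` S) = 0"
proof -
  define m where "m = DIM('a) - 1"
  have m: "real m = real DIM('a) - 1" "card (Basis - {b0}) = m"
    using b0 by (auto simp: m_def of_nat_diff Suc_le_eq)
  have "s > 0" using s m(1) by linarith
  have bound: "hausdorff_premeasure s \<delta> (f ` S) \<le>
      ennreal ((2 * real L * real N + 1) ^ m * (real m / real N) powr s)"
    if N: "N > 0" "real m / real N \<le> \<delta>" for N \<delta>
  proof -
    define I where "I = (Basis - {b0}) \<rightarrow>\<^sub>E {- int (L * N)..int (L * N)}"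
    define cell where "cell k = {p \<in> S. \<forall>b\<in>Basis - {b0}. \<lfloor>real N * (g p \<bullet> b)\<rfloor> = k b}"
      for k :: "'a \<Rightarrow> int"
    have "card I = nat (2 * int (L * N) + 1) ^ m"
      unfolding I_def by (subst card_PiE) (auto simp: m(2))
    then have cardI: "real (card I) = (2 * real L * real N + 1) ^ m"
      by (simp add: nat_add_distrib nat_mult_distrib algebra_simps)
    have finI: "finite I" unfolding I_def by (intro finite_PiE) auto
    have "f ` S \<subseteq> (\<Union>k\<in>I. f ` cell k)"
    proof
      fix y assume "y \<in> f ` S"
      then obtain p where p: "p \<in> S" "y = f p" by blast
      define k where "k = restrict (\<lambda>b. \<lfloor>real N * (g p \<bullet> b)\<rfloor>) (Basis - {b0})"
      have "\<lfloor>real N * (g p \<bullet> b)\<rfloor> \<in> {- int (L * N)..int (L * N)}" if "b \<in> Basis" for b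
      proof -
        have "\<bar>g p \<bullet> b\<bar> \<le> real L" using bdd[OF p(1)] Basis_le_norm[OF that, of "g p"] by linarith
        then have "\<bar>real N * (g p \<bullet> b)\<bar> \<le> real N * real L"
          by (simp add: abs_mult mult_left_mono)
        then have "real N * (g p \<bullet> b) \<le> real_of_int (int (L * N))"
            "real_of_int (- int (L * N)) \<le> real N * (g p \<bullet> b)"
          by (auto simp: mult.commute abs_le_iff)
        then show ?thesis by (simp only: atLeastAtMost_iff le_floor_iff floor_le_iff) auto
      qed
      then have "k \<in> I" by (auto simp: I_def k_def)
      moreover have "p \<in> cell k" using p by (auto simp: cell_def k_def)
      ultimately show "y \<in> (\<Union>k\<in>I. f ` cell k)" using p by blast
    qed
    moreover have "dist x y \<le> real m / real N" if xy: "x \<in> f ` cell k" "y \<in> f ` cell k" for k x y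
    proof -
      obtain p p' where p: "p \<in> cell k" "x = f p" "p' \<in> cell k" "y = f p'" using xy by blast
      then have S: "p \<in> S" "p' \<in> S" by (auto simp: cell_def)
      have coord: "\<bar>(g p - g p') \<bullet> b\<bar> \<le> (if b = b0 then 0 else 1 / real N)" if "b \<in> Basis" for b
      proof (cases "b = b0")
        case True
        then show ?thesis using plane S by (simp add: inner_diff_left)
      next
        case False
        then have "\<lfloor>real N * (g p \<bullet> b)\<rfloor> = \<lfloor>real N * (g p' \<bullet> b)\<rfloor>"
          using p that by (auto simp: cell_def)
        then have "\<bar>real N * (g p \<bullet> b) - real N * (g p' \<bullet> b)\<bar> \<le> 1" by linarith
        then have "real N * \<bar>(g p - g p') \<bullet> b\<bar> \<le> 1"
          by (simp add: inner_diff_left abs_mult flip: right_diff_distrib)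
        then show ?thesis using False N by (simp add: field_simps)
      qed
      have "dist x y \<le> norm (g p - g p')" using lip[OF S] p by (simp add: dist_norm)
      also have "\<dots> \<le> (\<Sum>b\<in>Basis. \<bar>(g p - g p') \<bullet> b\<bar>)" by (rule norm_le_l1)
      also have "\<dots> \<le> (\<Sum>b\<in>Basis. if b = b0 then 0 else 1 / real N)"
        by (intro sum_mono coord)
      also have "\<dots> = (\<Sum>b\<in>Basis - {b0}. 1 / real N)"
        by (intro sum.mono_neutral_cong_right) auto
      also have "\<dots> = real m / real N" by (simp add: m(2))
      finally show ?thesis .
    qed
    ultimately have "hausdorff_premeasure s \<delta> (f ` S) \<le> ennreal (real (card I) * (real m / real N) powr s)"
      using finI \<open>s > 0\<close> N by (intro hausdorff_premeasure_finite_cover[where U = "\<lambda>k. f ` cell k"]) auto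
    then show ?thesis by (simp add: cardI)
  qed
  have lim: "(\<lambda>N. (2 * real L * real N + 1) ^ m * (real m / real N) powr s) \<longlonglongrightarrow> 0"
  proof (rule Lim_null_comparison)
    have "(2 * real L * real N + 1) ^ m * (real m / real N) powr s
        \<le> (2 * real L + 1) ^ m * real m powr s * real N powr (real m - s)" if "N > 0" for N
    proof -
      \<comment> \<open>Since $2LN + 1 \<le> (2L+1)N$, the cost is at most a constant times $N^{m-s}$.\<close>
      have "(2 * real L * real N + 1) ^ m \<le> ((2 * real L + 1) * real N) ^ m"
        using that by (intro power_mono) (auto simp: algebra_simps)
      then have "(2 * real L * real N + 1) ^ m * (real m / real N) powr s
          \<le> ((2 * real L + 1) * real N) ^ m * (real m / real N) powr s"
        by (intro mult_right_mono) auto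
      also have "\<dots> = (2 * real L + 1) ^ m * real m powr s * real N powr (real m - s)"
        using that by (simp add: power_mult_distrib powr_divide powr_diff powr_realpow)
      finally show ?thesis .
    qed
    then show "\<forall>\<^sub>F N in sequentially. norm ((2 * real L * real N + 1) ^ m * (real m / real N) powr s)
        \<le> (2 * real L + 1) ^ m * real m powr s * real N powr (real m - s)"
      by (intro eventually_sequentiallyI[of 1]) auto
    have "(\<lambda>N. real N powr (real m - s)) \<longlonglongrightarrow> 0"
      using s m(1) by (intro tendsto_neg_powr filterlim_real_sequentially) auto
    then show "(\<lambda>N. (2 * real L + 1) ^ m * real m powr s * real N powr (real m - s)) \<longlonglongrightarrow> 0"
      by (rule tendsto_mult_right_zero)
  qed
  have "hausdorff_premeasure s \<delta> (f ` S) = 0" if "\<delta> > 0" for \<delta>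
  proof -
    have "(\<lambda>N. real m / real N) \<longlonglongrightarrow> 0" by (rule lim_const_over_n)
    then have "\<forall>\<^sub>F N in sequentially. real m / real N < \<delta>"
      using that by (rule order_tendstoD)
    then have ev: "\<forall>\<^sub>F N in sequentially. hausdorff_premeasure s \<delta> (f ` S) \<le>
        ennreal ((2 * real L * real N + 1) ^ m * (real m / real N) powr s)"
      using eventually_gt_at_top[of 0] by eventually_elim (auto intro!: bound)
    have "(\<lambda>N. ennreal ((2 * real L * real N + 1) ^ m * (real m / real N) powr s)) \<longlonglongrightarrow> ennreal 0"
      by (intro tendsto_ennrealI lim)
    then have "hausdorff_premeasure s \<delta> (f ` S) \<le> ennreal 0"
      by (rule tendsto_lowerbound) (use ev in auto)
    then show ?thesis by simp
  qed
  then show ?thesis by (simp add: hausdorff_measure_eq_0_iff)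
qed

lemma hausdorff_dim_le:
  assumes "\<And>s. s > c \<Longrightarrow> hausdorff_measure s A = 0" "0 \<le> c"
  shows "hausdorff_dim A \<le> ereal c"
proof (rule ereal_le_epsilon2)
  fix e :: real assume "e > 0"
  then have "hausdorff_dim A \<le> ereal (c + e)"
    unfolding hausdorff_dim_def using assms by (intro Inf_lower imageI) auto
  then show "hausdorff_dim A \<le> ereal c + ereal e" by simp
qed

section \<open>Subgradients of closed convex functions\<close>

text \<open>When the interior is empty, the set lies in a hyperplane, and a normal vector of it works;
  otherwise separate \<open>x\<close> from the interior and pass to the closure of the
  interior, which contains the whole set.\<close>

lemma convex_supporting_functional:
  fixes C :: "'a::euclidean_space set"
  assumes "convex C" "x \<notin> interior C" "x \<in> C"
  obtains n where "n \<noteq> 0" "\<And>y. y \<in> C \<Longrightarrow> n \<bullet> y \<le> n \<bullet> x"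
proof (cases "interior C = {}")
  case True
  then obtain a b where ab: "a \<noteq> 0" "C \<subseteq> {y. a \<bullet> y = b}"
    using empty_interior_subset_hyperplane[OF assms(1)] by blast
  have "a \<bullet> y \<le> a \<bullet> x" if "y \<in> C" for y
    using subsetD[OF ab(2) that] subsetD[OF ab(2) assms(3)] by simp
  with ab(1) show ?thesis by (rule that)
next
  case False
  obtain a b where ab: "a \<noteq> 0" "\<And>y. y \<in> interior C \<Longrightarrow> a \<bullet> y \<le> b" "a \<bullet> x \<ge> b"
    using separating_hyperplane_sets[of "interior C" "{x}"] False assms
    by (auto simp: convex_interior)
  have "closure (interior C) \<subseteq> {y. a \<bullet> y \<le> b}"
    using ab(2) by (intro closure_minimal closed_halfspace_le) auto
  then have "C \<subseteq> {y. a \<bullet> y \<le> b}"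
    using convex_closure_interior[OF assms(1) False] closure_subset by blast
  then have "a \<bullet> y \<le> a \<bullet> x" if "y \<in> C" for y
    using ab(3) that by (auto dest!: subsetD)
  with ab(1) show ?thesis by (rule that)
qed

lemma ereal_real_on_edom:
  assumes "closed_convex_fun \<psi>" "x \<in> edom \<psi>"
  shows "\<psi> x = ereal (real_of_ereal (\<psi> x))"
  using assms unfolding closed_convex_fun_def edom_def by (cases "\<psi> x") auto

lemma convex_epigraph_ereal:
  assumes "closed_convex_fun \<psi>"
  shows "convex {(x, r :: real). \<psi> x \<le> ereal r}"
  unfolding convex_alt
proof (clarsimp)
  fix x r y s and t :: real
  assume *: "\<psi> x \<le> ereal r" "\<psi> y \<le> ereal s" "0 \<le> t" "t \<le> 1"
  show "\<psi> ((1 - t) *\<^sub>R x + t *\<^sub>R y) \<le> ereal ((1 - t) * r + t * s)"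
  proof (cases "t = 0 \<or> t = 1")
    case True
    then show ?thesis using * by auto
  next
    case False
    then have "\<psi> ((1 - t) *\<^sub>R x + t *\<^sub>R y) \<le> ereal (1 - t) * \<psi> x + ereal t * \<psi> y"
      using assms * unfolding closed_convex_fun_def by simp
    also have "\<dots> \<le> ereal (1 - t) * ereal r + ereal t * ereal s"
      using * by (intro add_mono ereal_mult_left_mono) auto
    finally show ?thesis by simp
  qed
qed

lemma convex_on_edom:
  assumes "closed_convex_fun \<psi>"
  shows "convex_on (edom \<psi>) (\<lambda>x. real_of_ereal (\<psi> x))"
proof -
  let ?f = "\<lambda>x. real_of_ereal (\<psi> x)"
  have *: "u *\<^sub>R x + v *\<^sub>R y \<in> edom \<psi> \<and> ?f (u *\<^sub>R x + v *\<^sub>R y) \<le> u * ?f x + v * ?f y"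
    if "x \<in> edom \<psi>" "y \<in> edom \<psi>" "0 \<le> u" "0 \<le> v" "u + v = 1" for x y and u v :: real
  proof -
    have "u *\<^sub>R (x, ?f x) + v *\<^sub>R (y, ?f y) \<in> {(x, r). \<psi> x \<le> ereal r}"
      using that ereal_real_on_edom[OF assms]
      by (intro convexD[OF convex_epigraph_ereal[OF assms]]) auto
    then have le: "\<psi> (u *\<^sub>R x + v *\<^sub>R y) \<le> ereal (u * ?f x + v * ?f y)" by simp
    then have dom: "u *\<^sub>R x + v *\<^sub>R y \<in> edom \<psi>"
      unfolding edom_def by (auto intro: le_less_trans)
    then show ?thesis
      using le ereal_real_on_edom[OF assms dom] by (metis ereal_less_eq(3))
  qed
  then show ?thesis unfolding convex_on_def convex_def by blast
qed

text \<open>Points outside the domain impose no constraint, so the inequality can be stated with real values.\<close>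

lemma subdiff_iff_real:
  assumes "closed_convex_fun \<psi>"
  shows "(x, v) \<in> subdiff \<psi> \<longleftrightarrow> x \<in> edom \<psi> \<and>
    (\<forall>y\<in>edom \<psi>. real_of_ereal (\<psi> x) + (y - x) \<bullet> v \<le> real_of_ereal (\<psi> y))"
proof -
  let ?f = "\<lambda>x. real_of_ereal (\<psi> x)"
  have "\<psi> x + ereal ((y - x) \<bullet> v) \<le> \<psi> y \<longleftrightarrow> (y \<in> edom \<psi> \<longrightarrow> ?f x + (y - x) \<bullet> v \<le> ?f y)"
    if "x \<in> edom \<psi>" for y
  proof (cases "y \<in> edom \<psi>")
    case True
    have "\<psi> x = ereal (?f x)" "\<psi> y = ereal (?f y)"
      using ereal_real_on_edom[OF assms] that True by auto
    then show ?thesis using True by (metis ereal_less_eq(3) plus_ereal.simps(1))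
  qed (simp add: edom_def)
  then show ?thesis unfolding subdiff_def by auto
qed

lemma subdiff_monotone:
  assumes "closed_convex_fun \<psi>" "(x, v) \<in> subdiff \<psi>" "(y, w) \<in> subdiff \<psi>"
  shows "0 \<le> (x - y) \<bullet> (v - w)"
proof -
  have "real_of_ereal (\<psi> x) + (y - x) \<bullet> v \<le> real_of_ereal (\<psi> y)"
       "real_of_ereal (\<psi> y) + (x - y) \<bullet> w \<le> real_of_ereal (\<psi> x)"
    using assms(2,3) unfolding subdiff_iff_real[OF assms(1)] by auto
  then show ?thesis by (simp add: inner_diff_left inner_diff_right)
qed

text \<open>Expand the square of $(x-y)+(v-w)$; the mixed term is nonnegative.\<close>

lemma monotone_resolvent_nonexpansive:
  fixes x y v w :: "'a::real_inner"
  assumes "0 \<le> (x - y) \<bullet> (v - w)"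
  shows "dist x y \<le> dist (x + v) (y + w)"
proof -
  have "(norm ((x - y) + (v - w)))\<^sup>2 = (norm (x - y))\<^sup>2 + 2 * ((x - y) \<bullet> (v - w)) + (norm (v - w))\<^sup>2"
    by (simp only: dot_norm) (simp add: field_simps)
  then have "(norm (x - y))\<^sup>2 \<le> (norm ((x - y) + (v - w)))\<^sup>2"
    using assms by simp
  then show ?thesis
    by (simp add: dist_norm algebra_simps power2_le_iff_abs_le)
qed

text \<open>The subgradient inequality at $y$ says that $(x, \psi(y) - \langle y-x, v\rangle)$ lies in
  the epigraph. So the subdifferential is an intersection of preimages of the closed epigraph under
  continuous maps, taken over all $y$ in the domain. When the domain is nonempty, these conditions
  force $x$ into it.\<close>

lemma closed_subdiff:
  assumes "closed_convex_fun \<psi>"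
  shows "closed (subdiff \<psi>)"
proof (cases "edom \<psi> = {}")
  case True
  then show ?thesis by (simp add: subdiff_def)
next
  case False
  let ?f = "\<lambda>x. real_of_ereal (\<psi> x)"
  let ?E = "{(x, r :: real). \<psi> x \<le> ereal r}"
  have mem: "(x, ?f y - (y - x) \<bullet> v) \<in> ?E \<longleftrightarrow> x \<in> edom \<psi> \<and> ?f x + (y - x) \<bullet> v \<le> ?f y" for x y v
  proof (cases "x \<in> edom \<psi>")
    case True
    from ereal_real_on_edom[OF assms True]
    have "(x, ?f y - (y - x) \<bullet> v) \<in> ?E \<longleftrightarrow> ?f x \<le> ?f y - (y - x) \<bullet> v"
      by (metis (no_types, lifting) case_prod_conv ereal_less_eq(3) mem_Collect_eq)
    then show ?thesis using True by auto
  next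
    case False
    then show ?thesis by (auto simp: edom_def)
  qed
  have "(x, v) \<in> subdiff \<psi> \<longleftrightarrow> (\<forall>y\<in>edom \<psi>. (x, ?f y - (y - x) \<bullet> v) \<in> ?E)" for x v
    unfolding mem subdiff_iff_real[OF assms] using False by blast
  then have "subdiff \<psi> = (\<Inter>y\<in>edom \<psi>. (\<lambda>p. (fst p, ?f y - (y - fst p) \<bullet> snd p)) -` ?E)"
    by auto
  moreover have "closed ((\<lambda>p. (fst p, ?f y - (y - fst p) \<bullet> snd p)) -` ?E)" for y
    using assms unfolding closed_convex_fun_def
    by (intro continuous_closed_vimage) (auto intro!: continuous_intros)
  ultimately show ?thesis by (auto intro!: closed_INT)
qed

lemma subdiff_convex_fibre:
  assumes "closed_convex_fun \<psi>" "(x, v) \<in> subdiff \<psi>" "(x, w) \<in> subdiff \<psi>" "0 \<le> t" "t \<le> 1"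
  shows "(x, (1 - t) *\<^sub>R v + t *\<^sub>R w) \<in> subdiff \<psi>"
proof -
  let ?f = "\<lambda>x. real_of_ereal (\<psi> x)"
  have "?f x + (y - x) \<bullet> ((1 - t) *\<^sub>R v + t *\<^sub>R w) \<le> ?f y" if "y \<in> edom \<psi>" for y
  proof -
    have "?f x + (y - x) \<bullet> v \<le> ?f y" "?f x + (y - x) \<bullet> w \<le> ?f y"
      using that assms(2,3) unfolding subdiff_iff_real[OF assms(1)] by auto
    then have "(1 - t) * (?f x + (y - x) \<bullet> v) + t * (?f x + (y - x) \<bullet> w) \<le> ?f y"
      using assms(4,5) by (intro convex_bound_le) auto
    then show ?thesis by (simp add: inner_add_right algebra_simps)
  qed
  then show ?thesis using assms(2) unfolding subdiff_iff_real[OF assms(1)] by auto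
qed

text \<open>At any other point of the domain there is a nonzero normal vector, and adding it to a
  subgradient gives a second one.\<close>

lemma unique_subgradient_imp_interior:
  assumes "closed_convex_fun \<psi>" "(x, v) \<in> subdiff \<psi>" "\<And>w. (x, w) \<in> subdiff \<psi> \<Longrightarrow> w = v"
  shows "x \<in> interior (edom \<psi>)"
proof (rule ccontr)
  assume "x \<notin> interior (edom \<psi>)"
  moreover have "convex (edom \<psi>)" using convex_on_edom[OF assms(1)] convex_on_def by blast
  moreover have "x \<in> edom \<psi>" using assms(2) by (simp add: subdiff_def)
  ultimately obtain n where n: "n \<noteq> 0" "\<And>y. y \<in> edom \<psi> \<Longrightarrow> n \<bullet> y \<le> n \<bullet> x"
    by (metis convex_supporting_functional)
  have "(y - x) \<bullet> (v + n) \<le> (y - x) \<bullet> v" if "y \<in> edom \<psi>" for y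
    using n(2)[OF that] by (simp add: inner_add_right inner_diff_left inner_diff_right inner_commute[of _ n])
  then have "(x, v + n) \<in> subdiff \<psi>"
    using assms(2) unfolding subdiff_iff_real[OF assms(1)]
    by (meson add_left_mono order_trans)
  then show False using assms(3) n(1) by force
qed

text \<open>A supporting functional $(a, b)$ of the epigraph at $(x, \psi(x))$ has $b \<le> 0$ since
  the epigraph is unbounded upwards, and $b \<noteq> 0$ since otherwise $a$ would be maximal over
  a ball at its centre $x$. Then $-a/b$ is a subgradient.\<close>

lemma subgradient_exists_interior:
  assumes "closed_convex_fun \<psi>" "x \<in> interior (edom \<psi>)"
  shows "\<exists>v. (x, v) \<in> subdiff \<psi>"
proof -
  let ?f = "\<lambda>x. real_of_ereal (\<psi> x)"
  let ?E = "{(x, r :: real). \<psi> x \<le> ereal r}"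
  have x: "x \<in> edom \<psi>" using assms(2) interior_subset by blast
  have E: "(y, r) \<in> ?E" if "y \<in> edom \<psi>" "?f y \<le> r" for y r
    using ereal_real_on_edom[OF assms(1) that(1)] that(2)
    by (metis (no_types, lifting) case_prod_conv ereal_less_eq(3) mem_Collect_eq)
  have "(x, ?f x) \<notin> interior ?E"
  proof
    assume "(x, ?f x) \<in> interior ?E"
    then obtain e where e: "e > 0" "cball (x, ?f x) e \<subseteq> ?E" by (auto simp: mem_interior_cball)
    \<comment> \<open>A point straight below the graph lies outside the epigraph.\<close>
    have "(x, ?f x - e) \<in> cball (x, ?f x) e"
      using e(1) by (simp add: dist_Pair_Pair dist_real_def)
    then have "\<psi> x \<le> ereal (?f x - e)" using e(2) by auto
    then show False using ereal_real_on_edom[OF assms(1) x] e(1)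
      by (metis diff_add_cancel ereal_less_eq(3) less_add_same_cancel1 not_le)
  qed
  moreover have "(x, ?f x) \<in> ?E" using E x by blast
  ultimately obtain N where "N \<noteq> 0" "\<And>p. p \<in> ?E \<Longrightarrow> N \<bullet> p \<le> N \<bullet> (x, ?f x)"
    using convex_supporting_functional[OF convex_epigraph_ereal[OF assms(1)]] by metis
  moreover obtain a b where "N = (a, b)" by (cases N)
  ultimately have ab: "(a, b) \<noteq> 0"
    "\<And>y r. (y, r) \<in> ?E \<Longrightarrow> a \<bullet> y + b * r \<le> a \<bullet> x + b * ?f x" by auto
  have "b \<le> 0" using ab(2)[of x "?f x + 1"] E[of x "?f x + 1"] x by (simp add: algebra_simps)
  moreover have "b \<noteq> 0"
  proof
    assume "b = 0"
    then have "a \<noteq> 0" using ab(1) by (simp add: zero_prod_def)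
    obtain e where e: "e > 0" "cball x e \<subseteq> edom \<psi>" using assms(2) by (auto simp: mem_interior_cball)
    let ?y = "x + (e / norm a) *\<^sub>R a"
    have "?y \<in> edom \<psi>" using e \<open>a \<noteq> 0\<close> by (intro subsetD[OF e(2)]) (simp add: dist_norm)
    then have "a \<bullet> ?y \<le> a \<bullet> x" using ab(2)[of ?y "?f ?y"] E[of ?y "?f ?y"] \<open>b = 0\<close> by simp
    then have "e / norm a * (a \<bullet> a) \<le> 0" by (simp add: inner_add_right)
    moreover have "e / norm a * (a \<bullet> a) > 0" using e(1) \<open>a \<noteq> 0\<close> by simp
    ultimately show False by linarith
  qed
  ultimately have b: "b < 0" by simp
  have "?f x + (y - x) \<bullet> ((-1 / b) *\<^sub>R a) \<le> ?f y" if y: "y \<in> edom \<psi>" for y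
  proof -
    have "a \<bullet> y + b * ?f y \<le> a \<bullet> x + b * ?f x" using ab(2) E[OF y] by blast
    then have "a \<bullet> (y - x) \<le> (- b) * (?f y - ?f x)" by (simp add: inner_diff_right algebra_simps)
    then have "a \<bullet> (y - x) / (- b) \<le> ?f y - ?f x" using b
      by (subst pos_divide_le_eq) (simp_all add: mult.commute)
    then show ?thesis by (simp add: inner_commute)
  qed
  then show ?thesis using x unfolding subdiff_iff_real[OF assms(1)] by blast
qed

text \<open>Following a subgradient $v$ at $y$ over a distance $r$ raises $\psi$ by at least
  $r\,|v|$, while $\psi$ is continuous and hence bounded on compact balls inside the domain.\<close>

lemma subdiff_locally_bounded:
  assumes "closed_convex_fun \<psi>" "x \<in> interior (edom \<psi>)"
  obtains r K where "r > 0" "cball x r \<subseteq> interior (edom \<psi>)"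
    "\<And>y v. y \<in> cball x r \<Longrightarrow> (y, v) \<in> subdiff \<psi> \<Longrightarrow> norm v \<le> K"
proof -
  let ?f = "\<lambda>x. real_of_ereal (\<psi> x)"
  obtain R where R: "R > 0" "cball x R \<subseteq> interior (edom \<psi>)"
    using assms(2) open_contains_cball[of "interior (edom \<psi>)"] by auto
  have "convex_on (interior (edom \<psi>)) ?f"
    using convex_on_edom[OF assms(1)] convex_on_subset[OF _ interior_subset] convex_interior
    by (metis convex_on_imp_convex)
  then have "continuous_on (cball x R) ?f"
    using R(2) convex_on_continuous continuous_on_subset open_interior by blast
  then have "bounded (?f ` cball x R)"
    by (intro compact_imp_bounded compact_continuous_image) auto
  then obtain M where M: "\<And>y. y \<in> cball x R \<Longrightarrow> \<bar>?f y\<bar> \<le> M"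
    unfolding bounded_iff real_norm_def by blast
  define r where "r = R / 2"
  have r: "r > 0" "cball x r \<subseteq> cball x R" using R(1) by (auto simp: r_def)
  have "norm v \<le> 2 * M / r" if y: "y \<in> cball x r" and v: "(y, v) \<in> subdiff \<psi>" for y v
  proof (cases "v = 0")
    case True
    have "x \<in> cball x R" using R(1) by simp
    then have "0 \<le> M" using M by (meson abs_ge_zero order_trans)
    then show ?thesis using True r by simp
  next
    case False
    \<comment> \<open>Moving by \<open>r\<close> in the direction of \<open>v\<close> stays inside the larger ball of radius \<open>R = 2 r\<close>.\<close>
    let ?z = "y + (r / norm v) *\<^sub>R v"
    have "dist y ?z \<le> r" using False r(1) by (simp add: dist_norm)
    then have z: "?z \<in> cball x R" using y dist_triangle[of x ?z y] by (simp add: r_def)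
    then have "?z \<in> edom \<psi>" using R(2) interior_subset by blast
    then have "?f y + (?z - y) \<bullet> v \<le> ?f ?z" using v unfolding subdiff_iff_real[OF assms(1)] by blast
    moreover have "(?z - y) \<bullet> v = r * norm v"
      using False by (simp add: power2_norm_eq_inner[symmetric] power2_eq_square)
    moreover have "\<bar>?f ?z\<bar> \<le> M" "\<bar>?f y\<bar> \<le> M" using M z y r(2) by blast+
    ultimately have "r * norm v \<le> 2 * M" by linarith
    then show ?thesis using r(1) by (simp add: field_simps)
  qed
  with r R(2) show ?thesis by (intro that[of r]) auto
qed

text \<open>The subgradients near $x$ at distance at least $e$ from $v$ form a compact set of pairs, by
  closedness and local boundedness. Its projection is closed and misses $x$.\<close>

lemma subdiff_continuous_at_unique:
  assumes "closed_convex_fun \<psi>" "x \<in> interior (edom \<psi>)"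
    and uniq: "\<And>w. (x, w) \<in> subdiff \<psi> \<Longrightarrow> w = v" and "e > 0"
  obtains \<delta> where "\<delta> > 0" "ball x \<delta> \<subseteq> interior (edom \<psi>)"
    "\<And>y w. y \<in> ball x \<delta> \<Longrightarrow> (y, w) \<in> subdiff \<psi> \<Longrightarrow> norm (w - v) < e"
proof -
  obtain r K where r: "r > 0" "cball x r \<subseteq> interior (edom \<psi>)"
    "\<And>y v. y \<in> cball x r \<Longrightarrow> (y, v) \<in> subdiff \<psi> \<Longrightarrow> norm v \<le> K"
    using subdiff_locally_bounded[OF assms(1,2)] by blast
  \<comment> \<open>Pairs over the ball that violate the desired estimate.\<close>
  define F where "F = subdiff \<psi> \<inter> (cball x r \<times> (cball 0 K - ball v e))"
  have "compact F"
    unfolding F_def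
    by (intro closed_Int_compact closed_subdiff assms(1) compact_Times compact_cball compact_diff) auto
  then have "closed (fst ` F)"
    by (intro compact_imp_closed compact_continuous_image) (auto intro!: continuous_intros)
  moreover have "x \<notin> fst ` F"
    using uniq \<open>e > 0\<close> by (force simp: F_def)
  ultimately have "open (ball x r - fst ` F)" "x \<in> ball x r - fst ` F" using r(1) by auto
  then obtain \<delta> where \<delta>: "\<delta> > 0" "ball x \<delta> \<subseteq> ball x r - fst ` F"
    by (meson open_contains_ball)
  have "norm (w - v) < e" if "y \<in> ball x \<delta>" "(y, w) \<in> subdiff \<psi>" for y w
  proof (rule ccontr)
    assume "\<not> norm (w - v) < e"
    moreover have "y \<in> cball x r" using that(1) \<delta>(2) by auto
    ultimately have "(y, w) \<in> F"
      using that(2) r(3) by (auto simp: F_def dist_norm norm_minus_commute)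
    then show False using that(1) \<delta>(2) by force
  qed
  moreover have "ball x \<delta> \<subseteq> interior (edom \<psi>)" using \<delta>(2) r(2) ball_subset_cball[of x r] by blast
  ultimately show ?thesis using \<delta>(1) that by blast
qed

text \<open>With a subgradient $w$ at $y$, the two subgradient inequalities sandwich the linearisation
  error $\psi(y)-\psi(x)-\langle y-x,v\rangle$ between $0$ and $\langle y-x,w-v\rangle$,
  and $w$ is close to $v$ when $y$ is close to $x$.\<close>

lemma unique_subgradient_imp_has_gradient:
  assumes "closed_convex_fun \<psi>" "(x, v) \<in> subdiff \<psi>" "\<And>w. (x, w) \<in> subdiff \<psi> \<Longrightarrow> w = v"
  shows "has_gradient \<psi> x v"
proof -
  let ?f = "\<lambda>x. real_of_ereal (\<psi> x)"
  have int: "x \<in> interior (edom \<psi>)" by (rule unique_subgradient_imp_interior[OF assms])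
  have "\<exists>d>0. \<forall>y. norm (y - x) < d \<longrightarrow> norm (?f y - ?f x - (y - x) \<bullet> v) \<le> e * norm (y - x)"
    if e: "e > 0" for e
  proof -
    obtain d where d: "d > 0" "ball x d \<subseteq> interior (edom \<psi>)"
      "\<And>y w. y \<in> ball x d \<Longrightarrow> (y, w) \<in> subdiff \<psi> \<Longrightarrow> norm (w - v) < e"
      using subdiff_continuous_at_unique[OF assms(1) int assms(3) e] by blast
    have "norm (?f y - ?f x - (y - x) \<bullet> v) \<le> e * norm (y - x)" if "norm (y - x) < d" for y
    proof -
      have y: "y \<in> ball x d" using that by (simp add: dist_norm norm_minus_commute)
      then obtain w where w: "(y, w) \<in> subdiff \<psi>"
        using subgradient_exists_interior[OF assms(1)] d(2) by blast
      have "?f x + (y - x) \<bullet> v \<le> ?f y" "?f y + (x - y) \<bullet> w \<le> ?f x"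
        using w assms(2) unfolding subdiff_iff_real[OF assms(1)] by auto
      then have "norm (?f y - ?f x - (y - x) \<bullet> v) \<le> (y - x) \<bullet> (w - v)"
        by (simp add: inner_diff_left inner_diff_right)
      also have "\<dots> \<le> norm (y - x) * norm (w - v)" by (rule norm_cauchy_schwarz)
      also have "\<dots> \<le> norm (y - x) * e"
        using d(3)[OF y w] by (intro mult_left_mono) auto
      finally show ?thesis by (simp add: mult.commute)
    qed
    then show ?thesis using d(1) by blast
  qed
  then have "GDERIV ?f x :> v"
    unfolding gderiv_def has_derivative_at_alt by (simp add: bounded_linear_inner_left)
  with int show ?thesis by (simp add: has_gradient_def)
qed

text \<open>For a subgradient $w$ the function $\psi(y) - \langle y - x, w\rangle$ has a minimum at
  $x$, so its derivative $v - w$ vanishes; existence of some subgradient does the rest.\<close>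

lemma has_gradient_imp_unique_subgradient:
  assumes "closed_convex_fun \<psi>" "has_gradient \<psi> x v"
  shows "(x, w) \<in> subdiff \<psi> \<longleftrightarrow> w = v"
proof -
  let ?f = "\<lambda>x. real_of_ereal (\<psi> x)"
  have int: "x \<in> interior (edom \<psi>)" and D: "GDERIV ?f x :> v"
    using assms(2) by (auto simp: has_gradient_def)
  have x: "x \<in> edom \<psi>" using int interior_subset by blast
  have uniq: "w = v" if w: "(x, w) \<in> subdiff \<psi>" for w
  proof -
    obtain d where d: "d > 0" "ball x d \<subseteq> edom \<psi>" using int by (auto simp: mem_interior)
    have "((\<lambda>y. ?f y - (y - x) \<bullet> w) has_derivative (\<lambda>h. h \<bullet> v - h \<bullet> w)) (at x)"
      using D[unfolded gderiv_def] by (auto intro!: derivative_eq_intros)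
    moreover have "?f x - (x - x) \<bullet> w \<le> ?f y - (y - x) \<bullet> w" if "y \<in> ball x d" for y
      using w that d(2) unfolding subdiff_iff_real[OF assms(1)] by (auto simp: algebra_simps)
    ultimately have "(\<lambda>h. h \<bullet> v - h \<bullet> w) = (\<lambda>h. 0)"
      using d(1) by (intro differential_zero_maxmin[of x "ball x d"]) auto
    from fun_cong[OF this, of "v - w"] have "(v - w) \<bullet> (v - w) = 0"
      by (simp add: inner_diff_right)
    then show ?thesis by simp
  qed
  have "\<exists>w. (x, w) \<in> subdiff \<psi>" by (rule subgradient_exists_interior[OF assms(1) int])
  with uniq show ?thesis by blast
qed

lemma has_gradient_iff:
  assumes "closed_convex_fun \<psi>"
  shows "has_gradient \<psi> x v \<longleftrightarrow> (\<forall>w. (x, w) \<in> subdiff \<psi> \<longleftrightarrow> w = v)"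
  using has_gradient_imp_unique_subgradient[OF assms] unique_subgradient_imp_has_gradient[OF assms]
  by blast

lemma dom_grad_iff:
  assumes "closed_convex_fun \<psi>"
  shows "x \<in> dom_grad \<psi> \<longleftrightarrow> (\<exists>!v. (x, v) \<in> subdiff \<psi>)"
  unfolding dom_grad_def mem_Collect_eq has_gradient_iff[OF assms] by metis

lemma subdiff_iff_grad:
  assumes "closed_convex_fun \<psi>" "x \<in> dom_grad \<psi>"
  shows "(x, v) \<in> subdiff \<psi> \<longleftrightarrow> v = grad \<psi> x"
proof -
  obtain w where w: "has_gradient \<psi> x w" using assms(2) by (auto simp: dom_grad_def)
  then have "grad \<psi> x = w"
    unfolding grad_def using has_gradient_iff[OF assms(1)] by (intro the_equality) auto
  then show ?thesis using w has_gradient_iff[OF assms(1)] by auto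
qed

section \<open>Measurability of the gradient\<close>

text \<open>A closed set is a countable union of compact sets, and projections of these are compact.\<close>

lemma borel_fst_closed:
  fixes S :: "('a::euclidean_space \<times> 'b::euclidean_space) set"
  assumes "closed S"
  shows "fst ` S \<in> sets borel"
proof -
  have "fst ` S = (\<Union>n. fst ` (S \<inter> cball 0 (real n)))"
    using real_arch_simple by fastforce
  moreover have "compact (fst ` (S \<inter> cball 0 (real n)))" for n
    using assms by (intro compact_continuous_image closed_Int_compact) (auto intro!: continuous_intros)
  then have "(\<Union>n. fst ` (S \<inter> cball 0 (real n))) \<in> sets borel"
    by (intro sets.countable_UN) (auto intro: borel_compact)
  ultimately show ?thesis by simp
qed

text \<open>Asking for a gap of at least $1/(n+1)$ between the two values is a closed condition on
  triples, so the set is again a countable union of projections of closed sets.\<close>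

lemma borel_multivalued_closed:
  fixes S :: "('a::euclidean_space \<times> 'b::euclidean_space) set"
  assumes "closed S"
  shows "{x. \<exists>v w. (x, v) \<in> S \<and> (x, w) \<in> S \<and> v \<noteq> w} \<in> sets borel"
proof -
  define T where "T n = (\<lambda>p. (fst p, fst (snd p))) -` S \<inter> (\<lambda>p. (fst p, snd (snd p))) -` S
      \<inter> (\<lambda>p. norm (fst (snd p) - snd (snd p))) -` {1 / real (Suc n)..}" for n
  have "closed (T n)" for n
    unfolding T_def
    by (intro closed_Int continuous_closed_vimage assms) (auto intro!: continuous_intros)
  then have "(\<Union>n. fst ` T n) \<in> sets borel"
    by (intro sets.countable_UN) (auto intro: borel_fst_closed)
  moreover have "{x. \<exists>v w. (x, v) \<in> S \<and> (x, w) \<in> S \<and> v \<noteq> w} = (\<Union>n. fst ` T n)"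
  proof (intro equalityI subsetI)
    fix x assume "x \<in> {x. \<exists>v w. (x, v) \<in> S \<and> (x, w) \<in> S \<and> v \<noteq> w}"
    then obtain v w where vw: "(x, v) \<in> S" "(x, w) \<in> S" "v \<noteq> w" by blast
    then obtain n where "1 / real (Suc n) < norm (v - w)"
      using nat_approx_posE[of "norm (v - w)"] by auto
    then have "(x, v, w) \<in> T n" using vw by (simp add: T_def)
    then show "x \<in> (\<Union>n. fst ` T n)" by force
  next
    fix x assume "x \<in> (\<Union>n. fst ` T n)"
    then obtain n v w where "(x, v, w) \<in> T n" by force
    then have "(x, v) \<in> S" "(x, w) \<in> S" "v \<noteq> w" by (auto simp: T_def)
    then show "x \<in> {x. \<exists>v w. (x, v) \<in> S \<and> (x, w) \<in> S \<and> v \<noteq> w}" by blast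
  qed
  ultimately show ?thesis by simp
qed

lemma dom_grad_eq:
  assumes "closed_convex_fun \<psi>"
  shows "dom_grad \<psi> = fst ` subdiff \<psi> -
    {x. \<exists>v w. (x, v) \<in> subdiff \<psi> \<and> (x, w) \<in> subdiff \<psi> \<and> v \<noteq> w}"
proof (intro set_eqI)
  fix x
  have "x \<in> fst ` subdiff \<psi> \<longleftrightarrow> (\<exists>v. (x, v) \<in> subdiff \<psi>)" by force
  then show "x \<in> dom_grad \<psi> \<longleftrightarrow> x \<in> fst ` subdiff \<psi> -
      {x. \<exists>v w. (x, v) \<in> subdiff \<psi> \<and> (x, w) \<in> subdiff \<psi> \<and> v \<noteq> w}"
    unfolding dom_grad_iff[OF assms] by auto
qed

lemma borel_dom_grad:
  assumes "closed_convex_fun \<psi>"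
  shows "dom_grad \<psi> \<in> sets borel"
  unfolding dom_grad_eq[OF assms]
  by (intro sets.Diff borel_fst_closed borel_multivalued_closed closed_subdiff assms)

lemma borel_measurable_grad:
  assumes "closed_convex_fun \<psi>"
  shows "grad \<psi> \<in> borel_measurable (restrict_space borel (dom_grad \<psi>))"
proof (rule borel_measurableI)
  fix U :: "'a set" assume U: "open U"
  \<comment> \<open>The points whose gradient lies in the complement of \<open>U\<close>, up to points outside the domain of the gradient.\<close>
  let ?F = "fst ` (subdiff \<psi> \<inter> UNIV \<times> (- U))"
  have "?F \<in> sets borel"
    using U by (intro borel_fst_closed closed_Int closed_subdiff assms closed_Times) auto
  moreover have "x \<in> ?F \<longleftrightarrow> grad \<psi> x \<notin> U" if "x \<in> dom_grad \<psi>" for x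
  proof -
    have "x \<in> ?F \<longleftrightarrow> (\<exists>v. (x, v) \<in> subdiff \<psi> \<and> v \<notin> U)" by force
    then show ?thesis using subdiff_iff_grad[OF assms that] by simp
  qed
  then have "grad \<psi> -` U \<inter> space (restrict_space borel (dom_grad \<psi>)) = dom_grad \<psi> - ?F"
    by (auto simp: space_restrict_space)
  ultimately show "grad \<psi> -` U \<inter> space (restrict_space borel (dom_grad \<psi>))
      \<in> sets (restrict_space borel (dom_grad \<psi>))"
    using borel_dom_grad[OF assms] by (auto simp: sets_restrict_space_iff)
qed

lemma borel_grad_vimage:
  assumes "closed_convex_fun \<psi>" "B \<in> sets borel"
  shows "grad_vimage \<psi> B \<in> sets borel"
proof -
  have "grad \<psi> -` B \<inter> space (restrict_space borel (dom_grad \<psi>)) \<in> sets (restrict_space borel (dom_grad \<psi>))"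
    using borel_measurable_grad[OF assms(1)] assms(2) by (rule measurable_sets)
  moreover have "grad \<psi> -` B \<inter> space (restrict_space borel (dom_grad \<psi>)) = grad_vimage \<psi> B"
    by (auto simp: grad_vimage_def space_restrict_space)
  ultimately show ?thesis using borel_dom_grad[OF assms(1)] by (simp add: sets_restrict_space_iff)
qed


section \<open>Dimension of the set of points with several subgradients\<close>

text \<open>The sets \<open>S b q L\<close> of the proof collect the graph points $(x, v)$ with $x + v$ on a
  rational coordinate hyperplane and in a ball; their projections cover the multivalued points and
  are nonexpansive images of subsets of the hyperplane.\<close>

lemma hausdorff_dim_subdiff_multivalued:
  fixes \<psi> :: "'a::euclidean_space \<Rightarrow> ereal"
  assumes \<psi>: "closed_convex_fun \<psi>"
    and A: "A \<subseteq> {x. \<exists>v w. (x, v) \<in> subdiff \<psi> \<and> (x, w) \<in> subdiff \<psi> \<and> v \<noteq> w}"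
  shows "hausdorff_dim A \<le> ereal (real DIM('a) - 1)"
proof (rule hausdorff_dim_le)
  fix s :: real assume s: "s > real DIM('a) - 1"
  have dim: "real DIM('a) \<ge> 1" using DIM_positive[where 'a = 'a] by linarith
  define S where "S b q L = {(x, v) \<in> subdiff \<psi>. (x + v) \<bullet> b = q \<and> norm (x + v) \<le> real L}"
    for b :: 'a and q :: real and L :: nat
  have null: "hausdorff_measure s (fst ` S b q L) = 0" if "b \<in> Basis" for b q L
    using that s
  proof (intro hausdorff_measure_nonexpansive_hyperplane[where g = "\<lambda>(x, v). x + v" and q = q])
    fix p p' assume "p \<in> S b q L" "p' \<in> S b q L"
    then show "dist (fst p) (fst p') \<le> dist (case p of (x, v) \<Rightarrow> x + v) (case p' of (x, v) \<Rightarrow> x + v)"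
      by (auto simp: S_def intro!: monotone_resolvent_nonexpansive subdiff_monotone[OF \<psi>])
  qed (auto simp: S_def)
  have cover: "A \<subseteq> (\<Union>(b, q, L)\<in>Basis \<times> \<rat> \<times> UNIV. fst ` S b q L)"
  proof
    fix x assume "x \<in> A"
    then obtain v w where vw: "(x, v) \<in> subdiff \<psi>" "(x, w) \<in> subdiff \<psi>" "v \<noteq> w" using A by blast
    obtain b where b: "b \<in> Basis" "v \<bullet> b \<noteq> w \<bullet> b" using vw(3) by (auto simp: euclidean_eq_iff[of v w])
    have "\<exists>v w. (x, v) \<in> subdiff \<psi> \<and> (x, w) \<in> subdiff \<psi> \<and> v \<bullet> b < w \<bullet> b"
      using b(2) vw(1,2) by (meson linorder_neqE)
    then obtain v w where vw: "(x, v) \<in> subdiff \<psi>" "(x, w) \<in> subdiff \<psi>" "v \<bullet> b < w \<bullet> b" by blast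
    then have "(x + v) \<bullet> b < (x + w) \<bullet> b" by (simp add: inner_add_left)
    then obtain q where q: "q \<in> \<rat>" "(x + v) \<bullet> b < q" "q < (x + w) \<bullet> b"
      using Rats_dense_in_real by blast
    \<comment> \<open>Chosen so that the convex combination \<open>u\<close> of the two subgradients puts \<open>x + u\<close> on the hyperplane.\<close>
    define t where "t = (q - (x + v) \<bullet> b) / (w \<bullet> b - v \<bullet> b)"
    have t: "0 \<le> t" "t \<le> 1" using q vw(3) by (auto simp: t_def field_simps inner_add_left)
    define u where "u = (1 - t) *\<^sub>R v + t *\<^sub>R w"
    have "(x, u) \<in> subdiff \<psi>" unfolding u_def by (rule subdiff_convex_fibre[OF \<psi> vw(1,2) t])
    moreover have "(x + u) \<bullet> b = q"
    proof -
      have "(x + u) \<bullet> b = (x + v) \<bullet> b + t * (w \<bullet> b - v \<bullet> b)"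
        by (simp add: u_def inner_add_left algebra_simps)
      then show ?thesis using vw(3) by (simp add: t_def)
    qed
    moreover obtain L where "norm (x + u) \<le> real L" using real_arch_simple by blast
    ultimately have "(x, u) \<in> S b q L" by (simp add: S_def)
    then have "x \<in> fst ` S b q L" by force
    then show "x \<in> (\<Union>(b, q, L)\<in>Basis \<times> \<rat> \<times> UNIV. fst ` S b q L)"
      using b(1) q(1) by blast
  qed
  have count: "countable (Basis \<times> \<rat> \<times> UNIV :: ('a \<times> real \<times> nat) set)"
    by (intro countable_SIGMA) (auto simp: countable_rat countable_finite)
  show "hausdorff_measure s A = 0"
  proof (rule hausdorff_measure_countable_UN_null[OF count _ cover])
    fix i assume "i \<in> (Basis \<times> \<rat> \<times> UNIV :: ('a \<times> real \<times> nat) set)"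
    then show "hausdorff_measure s (case i of (b, q, L) \<Rightarrow> fst ` S b q L) = 0"
      using null by (cases i) simp
  qed (use s dim in linarith)
qed (use DIM_positive[where 'a = 'a] in linarith)


section \<open>Measures on the punctured space\<close>

lemma sets_punctured_borel_iff:
  fixes A :: "'a::{t1_space, zero} set"
  shows "A \<in> sets punctured_borel \<longleftrightarrow> A \<in> sets borel \<and> 0 \<notin> A"
  unfolding punctured_borel_def by (subst sets_restrict_space_iff) auto

lemma space_punctured_borel: "space punctured_borel = UNIV - {0}"
  by (simp add: punctured_borel_def space_restrict_space)

lemma emeasure_distr_restrict_punctured:
  fixes \<mu> :: "'a::{t1_space, zero} measure" and g :: "'a \<Rightarrow> 'b::topological_space"
  assumes \<mu>: "sets \<mu> = sets punctured_borel" and D: "D \<in> sets borel"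
    and g: "g \<in> borel_measurable (restrict_space borel D)" and X: "X \<in> sets borel"
  shows "emeasure (distr (restrict_space \<mu> D) borel g) X = emeasure \<mu> {x \<in> D - {0}. g x \<in> X}"
proof -
  have space: "space \<mu> = UNIV - {0}"
    using sets_eq_imp_space_eq[OF \<mu>] by (simp add: space_punctured_borel)
  have "sets (restrict_space \<mu> D) = sets (restrict_space (restrict_space borel D) (UNIV - {0}))"
    using D unfolding sets_restrict_space_cong[OF \<mu>] punctured_borel_def
    by (subst (1 2) restrict_restrict_space) (auto simp: Int_commute)
  then have g': "g \<in> borel_measurable (restrict_space \<mu> D)"
    using measurable_restrict_space1[OF g] by (subst measurable_cong_sets[OF _ refl])
  have sp: "space (restrict_space \<mu> D) = D - {0}"
    by (auto simp: space_restrict_space space)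
  have "D \<inter> space \<mu> \<in> sets \<mu>"
    using D by (auto simp: space \<mu> sets_punctured_borel_iff)
  then have "emeasure (restrict_space \<mu> D) (g -` X \<inter> (D - {0})) = emeasure \<mu> (g -` X \<inter> (D - {0}))"
    by (intro emeasure_restrict_space) auto
  moreover have "g -` X \<inter> (D - {0}) = {x \<in> D - {0}. g x \<in> X}" by auto
  ultimately show ?thesis using g' X by (simp add: emeasure_distr sp)
qed

lemma emeasure_grad_push:
  assumes "closed_convex_fun \<psi>" "sets \<mu> = sets punctured_borel" "B \<in> sets borel"
  shows "emeasure (grad_push \<psi> \<mu>) B = emeasure \<mu> (grad_vimage \<psi> B - {0})"
proof -
  have "{x \<in> dom_grad \<psi> - {0}. grad \<psi> x \<in> B} = grad_vimage \<psi> B - {0}"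
    by (auto simp: grad_vimage_def)
  then show ?thesis unfolding grad_push_def
    by (subst emeasure_distr_restrict_punctured)
       (simp_all add: assms borel_dom_grad borel_measurable_grad)
qed

lemma emeasure_id_grad_push_Times:
  assumes "closed_convex_fun \<psi>" "sets \<mu> = sets punctured_borel"
    and "A \<in> sets borel" "B \<in> sets borel"
  shows "emeasure (id_grad_push \<psi> \<mu>) (A \<times> B) = emeasure \<mu> ((A - {0}) \<inter> grad_vimage \<psi> B)"
proof -
  have "(\<lambda>x. (x, grad \<psi> x)) \<in> borel_measurable (restrict_space borel (dom_grad \<psi>))"
    by (intro borel_measurable_Pair borel_measurable_grad[OF assms(1)]
        measurable_restrict_space1[OF measurable_ident_sets[OF refl]])
  moreover have "{x \<in> dom_grad \<psi> - {0}. (x, grad \<psi> x) \<in> A \<times> B} = (A - {0}) \<inter> grad_vimage \<psi> B"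
    by (auto simp: grad_vimage_def)
  ultimately show ?thesis unfolding id_grad_push_def
    by (subst emeasure_distr_restrict_punctured)
       (simp_all add: assms borel_dom_grad borel_Times)
qed

text \<open>The complement of the support is a union of open sets that are null off $0$; by the Lindelof property
  countably many of them suffice.\<close>

lemma emeasure_compl_spt:
  fixes \<gamma> :: "'a::{second_countable_topology, t1_space, zero} measure"
  assumes \<gamma>: "sets \<gamma> = sets punctured_borel"
  shows "- spt \<gamma> - {0} \<in> null_sets \<gamma>"
proof -
  let ?\<U> = "{U. open U \<and> emeasure \<gamma> (U - {0}) = 0}"
  have "- spt \<gamma> = \<Union>?\<U>" by (auto simp: spt_def zero_less_iff_neq_zero)
  moreover obtain \<V> where \<V>: "\<V> \<subseteq> ?\<U>" "countable \<V>" "\<Union>\<V> = \<Union>?\<U>"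
    using Lindelof[of ?\<U>] by auto
  ultimately have "- spt \<gamma> - {0} = (\<Union>U\<in>\<V>. U - {0})" by auto
  moreover have "U - {0} \<in> null_sets \<gamma>" if "U \<in> \<V>" for U
  proof (rule null_setsI)
    have U: "open U" "emeasure \<gamma> (U - {0}) = 0" using that \<V>(1) by blast+
    show "emeasure \<gamma> (U - {0}) = 0" by (rule U)
    show "U - {0} \<in> sets \<gamma>" unfolding \<gamma> sets_punctured_borel_iff using U(1) by simp
  qed
  then have "(\<Union>U\<in>\<V>. U - {0}) \<in> null_sets \<gamma>" by (rule null_sets_UN'[OF \<V>(2)])
  ultimately show ?thesis by (simp only:)
qed

lemma compl_zero_eq_UN: "UNIV - {0 :: 'a::real_normed_vector} = (\<Union>n. {x. 1 / real (Suc n) \<le> norm x})"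
proof (intro equalityI subsetI)
  fix x :: 'a assume "x \<in> UNIV - {0}"
  then have "0 < norm x" by simp
  then obtain n where "1 / real (Suc n) < norm x" by (rule nat_approx_posE)
  then have "1 / real (Suc n) \<le> norm x" by (rule less_imp_le)
  then show "x \<in> (\<Union>n. {x. 1 / real (Suc n) \<le> norm x})" by blast
next
  fix x :: 'a assume "x \<in> (\<Union>n. {x. 1 / real (Suc n) \<le> norm x})"
  then obtain n where "1 / real (Suc n) \<le> norm x" by blast
  moreover have "0 < 1 / real (Suc n)" by simp
  ultimately have "0 < norm x" by (rule order.strict_trans2[rotated])
  then show "x \<in> UNIV - {0}" by simp
qed

lemma zero_notin_closure_far:
  fixes B :: "'a::real_normed_vector set"
  shows "0 \<notin> closure (B \<inter> {x. 1 / real (Suc n) \<le> norm x})"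
proof -
  have "closure (B \<inter> {x. 1 / real (Suc n) \<le> norm x}) \<subseteq> {x. 1 / real (Suc n) \<le> norm x}"
    by (intro closure_minimal closed_Collect_le continuous_intros) simp
  then show ?thesis by (rule contra_subsetD) simp
qed

text \<open>Over $0$ the two measures are compared only on sets at positive distance from the origin;
  cutting off small balls recovers the whole fibre from these. The sets $\{|x| \<ge> 1/(n+1)\}$
  exhaust the complement of the origin and give both the countable cover by sets of finite measure
  and the remaining product sets.\<close>

lemma punctured_product_measure_eqI:
  fixes \<gamma> \<gamma>' :: "('a::euclidean_space \<times> 'a) measure"
  assumes sets: "sets \<gamma> = sets punctured_borel" "sets \<gamma>' = sets punctured_borel"
    and eq: "\<And>A B. A \<in> sets punctured_borel \<Longrightarrow> B \<in> sets borel \<Longrightarrow>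
               emeasure \<gamma> (A \<times> B) = emeasure \<gamma>' (A \<times> B)"
    and eq0: "\<And>B. B \<in> sets borel \<Longrightarrow> 0 \<notin> closure B \<Longrightarrow>
               emeasure \<gamma> ({0} \<times> B) = emeasure \<gamma>' ({0} \<times> B)"
    and fin: "\<And>A. A \<in> sets punctured_borel \<Longrightarrow> 0 \<notin> closure A \<Longrightarrow> emeasure \<gamma> (A \<times> UNIV) \<noteq> \<infinity>"
    and fin0: "\<And>B. B \<in> sets borel \<Longrightarrow> 0 \<notin> closure B \<Longrightarrow> emeasure \<gamma> ({0} \<times> B) \<noteq> \<infinity>"
  shows "\<gamma> = \<gamma>'"
proof -
  let ?\<Omega> = "UNIV - {0 :: 'a \<times> 'a}"
  define R :: "nat \<Rightarrow> 'a set" where "R n = {x. 1 / real (Suc n) \<le> norm x}" for n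
  have R: "R n \<in> sets borel" "0 \<notin> R n" "0 \<notin> closure (B \<inter> R n)" for n B
    using zero_notin_closure_far[of B n] unfolding R_def by (auto intro!: closed_Collect_le continuous_intros)
  have UR: "(\<Union>n. R n) = UNIV - {0}" unfolding R_def compl_zero_eq_UN ..
  define E where "E = {A \<times> B | A B. A \<in> sets punctured_borel \<and> B \<in> sets borel} \<union>
      {{0 :: 'a} \<times> B | B. B \<in> sets borel \<and> (0 :: 'a) \<notin> closure B}"
  have EI: "A \<times> B \<in> E" if "A \<in> sets punctured_borel" "B \<in> sets borel" for A B
    using that unfolding E_def by blast
  have E0: "{0} \<times> B \<in> E" if "B \<in> sets borel" "0 \<notin> closure B" for B
    using that unfolding E_def by blast
  have Ecases: "(\<exists>A B. X = A \<times> B \<and> A \<in> sets punctured_borel \<and> B \<in> sets borel) \<or>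
      (\<exists>B. X = {0} \<times> B \<and> B \<in> sets borel \<and> 0 \<notin> closure B)" if "X \<in> E" for X
    using that unfolding E_def by blast
  have Esub: "X \<in> sets punctured_borel" if "X \<in> E" for X
    using Ecases[OF that] closure_subset
    by (auto simp: sets_punctured_borel_iff zero_prod_def intro!: borel_Times)
  have stable: "Int_stable E"
  proof (rule Int_stableI)
    fix X Y assume X: "X \<in> E" and Y: "Y \<in> E"
    have empty: "{} \<in> E" using EI[of "{}" "{}"] by (simp add: sets_punctured_borel_iff)
    have mixed: "A \<times> B \<inter> {0} \<times> B' = {}" if "A \<in> sets punctured_borel" for A B B' :: "'a set"
      using that by (auto simp: sets_punctured_borel_iff)
    from Ecases[OF X] Ecases[OF Y] show "X \<inter> Y \<in> E"
    proof (elim disjE exE conjE)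
      fix A B A' B' assume "X = A \<times> B" "A \<in> sets punctured_borel" "B \<in> sets borel"
        "Y = A' \<times> B'" "A' \<in> sets punctured_borel" "B' \<in> sets borel"
      then show ?thesis by (simp add: Times_Int_Times EI)
    next
      fix B B' assume "X = {0} \<times> B" "B \<in> sets borel" "0 \<notin> closure B" "Y = {0} \<times> B'" "B' \<in> sets borel"
      moreover have "closure (B \<inter> B') \<subseteq> closure B" by (intro closure_mono) auto
      ultimately show ?thesis by (auto simp: Times_Int_Times intro!: E0)
    qed (use mixed empty in \<open>auto simp: Int_commute\<close>)
  qed
  have gen: "sets punctured_borel = sigma_sets ?\<Omega> E"
  proof (intro equalityI)
    show "sigma_sets ?\<Omega> E \<subseteq> sets punctured_borel"
      using sets.sigma_sets_subset[of E punctured_borel] Esub by (auto simp: space_punctured_borel)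
    let ?G = "{A \<times> B | A B. A \<in> sets (borel :: 'a measure) \<and> B \<in> sets (borel :: 'a measure)}"
    have "sets (borel :: ('a \<times> 'a) measure) = sigma_sets UNIV ?G"
      by (simp add: borel_prod[symmetric] sets_pair_measure)
    then have "sets (punctured_borel :: ('a \<times> 'a) measure) = (\<inter>) ?\<Omega> ` sigma_sets UNIV ?G"
      by (simp add: punctured_borel_def sets_restrict_space)
    also have "\<dots> = sigma_sets ?\<Omega> ((\<inter>) ?\<Omega> ` ?G)"
    proof (rule sigma_sets_Int)
      show "?\<Omega> \<in> sigma_sets UNIV ?G"
        unfolding \<open>sets (borel :: ('a \<times> 'a) measure) = sigma_sets UNIV ?G\<close>[symmetric] by auto
    qed simp
    also have "\<dots> \<subseteq> sigma_sets ?\<Omega> E"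
    proof (rule sigma_sets_mono, clarsimp)
      fix A B :: "'a set" assume AB: "A \<in> sets borel" "B \<in> sets borel"
      have 1: "(A - {0}) \<times> B \<in> sigma_sets ?\<Omega> E"
        using AB by (intro sigma_sets.Basic EI) (auto simp: sets_punctured_borel_iff)
      have 2: "(\<Union>n. {0} \<times> (B \<inter> R n)) \<in> sigma_sets ?\<Omega> E"
        using AB R by (intro sigma_sets.Union sigma_sets.Basic E0) auto
      have "?\<Omega> \<inter> A \<times> B = (A - {0}) \<times> B \<union> (if 0 \<in> A then {0} \<times> (B - {0}) else {})"
        by (auto simp: zero_prod_def)
      also have "{0} \<times> (B - {0}) = (\<Union>n. {0 :: 'a} \<times> (B \<inter> R n))"
      proof -
        have "B - {0} = (\<Union>n. B \<inter> R n)" using UR by blast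
        then show ?thesis by blast
      qed
      finally show "?\<Omega> \<inter> A \<times> B \<in> sigma_sets ?\<Omega> E"
        using 1 sigma_sets_Un[OF 1 2] by (simp split: if_splits)
    qed
    finally show "sets punctured_borel \<subseteq> sigma_sets ?\<Omega> E" .
  qed
  show ?thesis
  proof (rule measure_eqI_generator_eq_countable[OF stable])
    let ?C = "range (\<lambda>n. R n \<times> UNIV) \<union> range (\<lambda>n. {0} \<times> R n)"
    have RP: "R n \<in> sets punctured_borel" for n using R by (simp add: sets_punctured_borel_iff)
    have RC: "0 \<notin> closure (R n)" for n using R(3)[of UNIV n] by simp
    show "E \<subseteq> Pow ?\<Omega>" using Esub by (auto simp: sets_punctured_borel_iff)
    show "emeasure \<gamma> X = emeasure \<gamma>' X" if "X \<in> E" for X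
      using Ecases[OF that] eq eq0 by auto
    show "sets \<gamma> = sigma_sets ?\<Omega> E" "sets \<gamma>' = sigma_sets ?\<Omega> E" using sets gen by auto
    show "?C \<subseteq> E" using EI[OF RP] E0[OF R(1) RC] by auto
    have "\<Union>?C = (UNIV - {0}) \<times> UNIV \<union> {0} \<times> (UNIV - {0})" unfolding UR[symmetric] by auto
    also have "\<dots> = ?\<Omega>" by (auto simp: zero_prod_def)
    finally show "\<Union>?C = ?\<Omega>" .
    show "countable ?C" by auto
    show "emeasure \<gamma> X \<noteq> \<infinity>" if "X \<in> ?C" for X
      using that fin[OF RP RC] fin0[OF R(1) RC] by auto
  qed
qed


section \<open>Couplings supported in a subdifferential\<close>

text \<open>A point outside the domain of the gradient either has no subgradient, and then the fibre of
  the coupling above it misses the support, or it has several.\<close>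

lemma null_compl_dom_grad:
  fixes \<mu> \<nu> :: "'a::euclidean_space measure"
  assumes \<mu>: "sets \<mu> = sets punctured_borel" and \<gamma>: "zero_coupling \<mu> \<nu> \<gamma>"
    and small: "\<And>A. A \<in> sets punctured_borel \<Longrightarrow> hausdorff_dim A \<le> ereal (real DIM('a) - 1)
                  \<Longrightarrow> emeasure \<mu> A = 0"
    and \<psi>: "closed_convex_fun \<psi>" and spt: "spt \<gamma> \<subseteq> subdiff \<psi>"
  shows "(UNIV - {0}) - dom_grad \<psi> \<in> null_sets \<mu>"
proof -
  let ?M = "{x. \<exists>v w. (x, v) \<in> subdiff \<psi> \<and> (x, w) \<in> subdiff \<psi> \<and> v \<noteq> w}"
  let ?N = "UNIV - {0} - fst ` subdiff \<psi>"
  have s\<gamma>: "sets \<gamma> = sets punctured_borel" using \<gamma> by (simp add: zero_coupling_def)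
  have N: "?N \<in> sets punctured_borel"
    using borel_fst_closed[OF closed_subdiff[OF \<psi>]] by (auto simp: sets_punctured_borel_iff)
  have "emeasure \<mu> ?N = emeasure \<gamma> (?N \<times> UNIV)" using \<gamma> N by (simp add: zero_coupling_def)
  also have "\<dots> \<le> emeasure \<gamma> (- spt \<gamma> - {0})"
  proof (rule emeasure_mono)
    have "x \<in> fst ` subdiff \<psi>" if "(x, v) \<in> spt \<gamma>" for x v
      using subsetD[OF spt that] by force
    then show "?N \<times> UNIV \<subseteq> - spt \<gamma> - {0}" by (auto simp: zero_prod_def)
    show "- spt \<gamma> - {0} \<in> sets \<gamma>" using emeasure_compl_spt[OF s\<gamma>] by (rule null_setsD2)
  qed
  also have "\<dots> = 0" using emeasure_compl_spt[OF s\<gamma>] by (rule null_setsD1)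
  finally have "?N \<in> null_sets \<mu>" using N \<mu> by (intro null_setsI) simp_all
  moreover have "?M - {0} \<in> sets punctured_borel"
    using borel_multivalued_closed[OF closed_subdiff[OF \<psi>]] by (auto simp: sets_punctured_borel_iff)
  then have "?M - {0} \<in> null_sets \<mu>"
    using hausdorff_dim_subdiff_multivalued[OF \<psi>, of "?M - {0}"] small \<mu>
    by (intro null_setsI) blast+
  ultimately have "?N \<union> (?M - {0}) \<in> null_sets \<mu>" by (rule null_sets.Un)
  moreover have "?N \<union> (?M - {0}) = (UNIV - {0}) - dom_grad \<psi>"
    unfolding dom_grad_eq[OF \<psi>] by auto
  ultimately show ?thesis by simp
qed

text \<open>Away from the null sets over non-differentiability points and off the support, membership of
  $(x,v)$ in $A \times B$ depends on $x$ alone, since $v = \nabla\psi(x)$.\<close>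

lemma coupling_Times_eq:
  fixes \<mu> \<nu> :: "'a::euclidean_space measure"
  assumes \<mu>: "sets \<mu> = sets punctured_borel" and \<gamma>: "zero_coupling \<mu> \<nu> \<gamma>"
    and null: "(UNIV - {0}) - dom_grad \<psi> \<in> null_sets \<mu>"
    and \<psi>: "closed_convex_fun \<psi>" and spt: "spt \<gamma> \<subseteq> subdiff \<psi>"
    and A: "A \<in> sets punctured_borel" and B: "B \<in> sets borel"
  shows "emeasure \<gamma> (A \<times> B) = emeasure \<mu> (A \<inter> grad_vimage \<psi> B)"
proof -
  have s\<gamma>: "sets \<gamma> = sets punctured_borel" using \<gamma> by (simp add: zero_coupling_def)
  let ?N = "(UNIV - {0}) - dom_grad \<psi>" and ?V = "A \<inter> grad_vimage \<psi> B"
  have marg: "emeasure \<gamma> (X \<times> UNIV) = emeasure \<mu> X" if "X \<in> sets punctured_borel" for X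
    using \<gamma> that by (simp add: zero_coupling_def)
  have Times: "X \<times> Y \<in> sets \<gamma>" if "X \<in> sets punctured_borel" "Y \<in> sets borel" for X Y
    using that by (auto simp: s\<gamma> sets_punctured_borel_iff zero_prod_def intro!: borel_Times)
  have N: "?N \<in> sets punctured_borel" using null \<mu> by auto
  have V: "?V \<in> sets punctured_borel"
    using A borel_grad_vimage[OF \<psi> B] by (auto simp: sets_punctured_borel_iff)
  define Z where "Z = ?N \<times> UNIV \<union> (- spt \<gamma> - {0})"
  have "?N \<times> UNIV \<in> null_sets \<gamma>"
    using null_setsD1[OF null] marg[OF N] Times[OF N, of UNIV] by (intro null_setsI) simp_all
  then have Z: "Z \<in> null_sets \<gamma>" unfolding Z_def using emeasure_compl_spt[OF s\<gamma>] by auto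
  have "A \<times> B - Z = ?V \<times> UNIV - Z"
  proof -
    have "v \<in> B \<longleftrightarrow> x \<in> grad_vimage \<psi> B" if "x \<in> A" "(x, v) \<notin> Z" for x v
    proof -
      have "x \<noteq> 0" using that(1) A by (auto simp: sets_punctured_borel_iff)
      then have "x \<in> dom_grad \<psi>" "(x, v) \<in> subdiff \<psi>"
        using that(2) spt by (auto simp: Z_def zero_prod_def)
      then show ?thesis using subdiff_iff_grad[OF \<psi>] by (simp add: grad_vimage_def)
    qed
    then show ?thesis by blast
  qed
  then have "emeasure \<gamma> (A \<times> B) = emeasure \<gamma> (?V \<times> UNIV)"
    using emeasure_Diff_null_set[OF Z Times[OF A B]] emeasure_Diff_null_set[OF Z Times[OF V, of UNIV]]
    by simp
  then show ?thesis by (simp add: marg[OF V])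
qed

theorem theorem2p9:
  fixes \<mu> \<nu> :: "'a::euclidean_space measure"
    and \<gamma> :: "('a \<times> 'a) measure"
    and \<psi> :: "'a \<Rightarrow> ereal"
  assumes "\<mu> \<in> M0" and "\<nu> \<in> M0"
    and "\<gamma> \<in> Gamma0_cm \<mu> \<nu>"
    and "\<And>A. A \<in> sets punctured_borel \<Longrightarrow> hausdorff_dim A \<le> ereal (real DIM('a) - 1)
           \<Longrightarrow> emeasure \<mu> A = 0"
    and "closed_convex_fun \<psi>"
    and "spt \<gamma> \<subseteq> subdiff \<psi>"
  shows
   "((UNIV - {0}) - dom_grad \<psi> \<in> null_sets \<mu>) \<and>
    (\<forall>B \<in> sets punctured_borel.
          emeasure \<nu> B = emeasure (grad_push \<psi> \<mu>) B + emeasure \<gamma> ({0} \<times> B)) \<and>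
    (\<forall>A \<in> sets punctured_borel. \<forall>B \<in> sets borel.
          emeasure \<gamma> (A \<times> B) = emeasure (id_grad_push \<psi> \<mu>) (A \<times> B) \<and>
          emeasure (id_grad_push \<psi> \<mu>) (A \<times> B) = emeasure \<mu> (A \<inter> grad_vimage \<psi> B)) \<and>
    (\<forall>B \<in> sets borel. 0 \<notin> closure B \<longrightarrow>
          emeasure \<gamma> ({0} \<times> B) = emeasure \<nu> B - emeasure (grad_push \<psi> \<mu>) B) \<and>
    (\<forall>\<gamma>' :: ('a \<times> 'a) measure.
          sets \<gamma>' = sets punctured_borel \<and>
          (\<forall>A \<in> sets punctured_borel. \<forall>B \<in> sets borel.
             emeasure \<gamma>' (A \<times> B) = emeasure \<mu> (A \<inter> grad_vimage \<psi> B)) \<and>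
          (\<forall>B \<in> sets borel. 0 \<notin> closure B \<longrightarrow>
             emeasure \<gamma>' ({0} \<times> B) = emeasure \<nu> B - emeasure (grad_push \<psi> \<mu>) B)
          \<longrightarrow> \<gamma>' = \<gamma>) \<and>
    (proper_zero_coupling \<gamma> \<longrightarrow>
          \<gamma> = res (id_grad_push \<psi> \<mu>) \<and> \<nu> = res (grad_push \<psi> \<mu>))"
proof -
  note \<psi> = assms(5) and spt = assms(6)
  have \<mu>: "sets \<mu> = sets punctured_borel" and \<nu>: "sets \<nu> = sets punctured_borel"
    using assms(1,2) by (auto simp: M0_def)
  have zc: "zero_coupling \<mu> \<nu> \<gamma>" using assms(3) by (simp add: Gamma0_cm_def)
  then have s\<gamma>: "sets \<gamma> = sets punctured_borel" by (simp add: zero_coupling_def)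
  have marg: "emeasure \<gamma> (X \<times> UNIV) = emeasure \<mu> X" "emeasure \<gamma> (UNIV \<times> X) = emeasure \<nu> X"
    if "X \<in> sets punctured_borel" for X
    using zc that by (auto simp: zero_coupling_def)
  have Times: "X \<times> Y \<in> sets \<gamma>"
    if "X \<in> sets borel" "Y \<in> sets borel" "0 \<notin> X \<or> 0 \<notin> Y" for X Y
    using that by (auto simp: s\<gamma> sets_punctured_borel_iff zero_prod_def intro!: borel_Times)
  have pos: "UNIV - {0} \<in> sets (punctured_borel :: 'a measure)"
    by (auto simp: sets_punctured_borel_iff)
  have far: "B \<in> sets punctured_borel" if "B \<in> sets borel" "0 \<notin> closure B" for B :: "'a set"
    using that closure_subset by (auto simp: sets_punctured_borel_iff)

  have null: "(UNIV - {0}) - dom_grad \<psi> \<in> null_sets \<mu>"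
    by (rule null_compl_dom_grad[OF \<mu> zc assms(4) \<psi> spt])
  note Times_eq = coupling_Times_eq[OF \<mu> zc null \<psi> spt]

  have first: "emeasure \<nu> B = emeasure (grad_push \<psi> \<mu>) B + emeasure \<gamma> ({0} \<times> B)"
    if B: "B \<in> sets punctured_borel" for B
  proof -
    have B': "B \<in> sets borel" "0 \<notin> B" using B by (auto simp: sets_punctured_borel_iff)
    have "(UNIV - {0 :: 'a}) \<times> B \<union> {0} \<times> B = UNIV \<times> B" by auto
    then have "emeasure \<nu> B = emeasure \<gamma> ((UNIV - {0}) \<times> B \<union> {0} \<times> B)"
      by (simp only: marg(2)[OF B])
    also have "\<dots> = emeasure \<gamma> ((UNIV - {0}) \<times> B) + emeasure \<gamma> ({0} \<times> B)"
      using B' by (intro plus_emeasure[symmetric] Times) auto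
    also have "emeasure \<gamma> ((UNIV - {0}) \<times> B) = emeasure (grad_push \<psi> \<mu>) B"
      unfolding Times_eq[OF pos B'(1)] emeasure_grad_push[OF \<psi> \<mu> B'(1)]
      by (rule arg_cong[where f = "emeasure \<mu>"]) auto
    finally show ?thesis .
  qed
  have id_push: "emeasure (id_grad_push \<psi> \<mu>) (A \<times> B) = emeasure \<mu> (A \<inter> grad_vimage \<psi> B)"
    if "A \<in> sets punctured_borel" "B \<in> sets borel" for A B
    using that emeasure_id_grad_push_Times[OF \<psi> \<mu>, of A B] by (auto simp: sets_punctured_borel_iff)
  have id_eq: "emeasure \<gamma> (A \<times> B) = emeasure (id_grad_push \<psi> \<mu>) (A \<times> B)"
    if "A \<in> sets punctured_borel" "B \<in> sets borel" for A B
    using Times_eq[OF that] id_push[OF that] by simp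
  have fin: "emeasure \<mu> B < \<infinity>" "emeasure \<nu> B < \<infinity>" if "B \<in> sets borel" "0 \<notin> closure B" for B
    using assms(1,2) far[OF that] that(2) by (auto simp: M0_def)
  have fibre: "emeasure \<gamma> ({0} \<times> B) = emeasure \<nu> B - emeasure (grad_push \<psi> \<mu>) B"
    if "B \<in> sets borel" "0 \<notin> closure B" for B
  proof -
    have "emeasure (grad_push \<psi> \<mu>) B \<le> emeasure \<nu> B" using first[OF far[OF that]] by simp
    then have "emeasure (grad_push \<psi> \<mu>) B \<noteq> \<infinity>" using fin(2)[OF that] by (auto simp: top_unique)
    then show ?thesis using first[OF far[OF that]] by (simp add: ennreal_add_diff_cancel_left)
  qed
  have unique: "\<gamma>' = \<gamma>" if "sets \<gamma>' = sets punctured_borel"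
    "\<forall>A \<in> sets punctured_borel. \<forall>B \<in> sets borel.
        emeasure \<gamma>' (A \<times> B) = emeasure \<mu> (A \<inter> grad_vimage \<psi> B)"
    "\<forall>B \<in> sets borel. 0 \<notin> closure B \<longrightarrow>
        emeasure \<gamma>' ({0} \<times> B) = emeasure \<nu> B - emeasure (grad_push \<psi> \<mu>) B" for \<gamma>'
  proof (rule punctured_product_measure_eqI[OF s\<gamma> that(1), symmetric])
    show "emeasure \<gamma> (A \<times> UNIV) \<noteq> \<infinity>" if "A \<in> sets punctured_borel" "0 \<notin> closure A" for A
      using marg(1)[OF that(1)] fin(1)[of A] that by (auto simp: sets_punctured_borel_iff)
    show "emeasure \<gamma> ({0} \<times> B) \<noteq> \<infinity>" if "B \<in> sets borel" "0 \<notin> closure B" for B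
    proof -
      have "emeasure \<gamma> ({0} \<times> B) \<le> emeasure \<nu> B" using first[OF far[OF that]] by simp
      then show ?thesis using fin(2)[OF that] by (auto simp: top_unique)
    qed
  qed (use that Times_eq fibre in auto)
  have proper: "\<gamma> = res (id_grad_push \<psi> \<mu>) \<and> \<nu> = res (grad_push \<psi> \<mu>)" if "proper_zero_coupling \<gamma>"
  proof -
    have zero: "emeasure \<gamma> ({0} \<times> B) = 0" if "B \<in> sets punctured_borel" for B
    proof -
      have "emeasure \<gamma> ({0} \<times> B) \<le> emeasure \<gamma> ({0} \<times> (UNIV - {0}))"
        using that by (intro emeasure_mono Times) (auto simp: sets_punctured_borel_iff)
      then show ?thesis using \<open>proper_zero_coupling \<gamma>\<close> by (simp add: proper_zero_coupling_def)
    qed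
    have res: "emeasure (res m) X = emeasure m X" "sets (res m) = sets punctured_borel"
      if "sets m = sets borel" "X \<in> sets punctured_borel"
      for m :: "'b::{t1_space, zero} measure" and X
    proof -
      have "UNIV - {0} \<in> sets m" using that(1) by auto
      then show "emeasure (res m) X = emeasure m X"
        using that sets_eq_imp_space_eq[OF that(1)] unfolding res_def
        by (intro emeasure_restrict_space) (auto simp: sets_punctured_borel_iff)
      show "sets (res m) = sets punctured_borel"
        unfolding res_def punctured_borel_def by (rule sets_restrict_space_cong[OF that(1)])
    qed
    have s: "sets (id_grad_push \<psi> \<mu>) = sets borel" "sets (grad_push \<psi> \<mu>) = sets borel"
      by (simp_all add: id_grad_push_def grad_push_def)
    \<comment> \<open>Over $0$ both sides vanish: the pushforward because $\mu$ does not see $0$, the coupling because it is proper.\<close>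
    have "res (id_grad_push \<psi> \<mu>) = \<gamma>"
    proof (rule unique)
      show "sets (res (id_grad_push \<psi> \<mu>)) = sets punctured_borel"
        by (rule res(2)[OF s(1) sets.empty_sets])
      show "\<forall>A\<in>sets punctured_borel. \<forall>B\<in>sets borel.
          emeasure (res (id_grad_push \<psi> \<mu>)) (A \<times> B) = emeasure \<mu> (A \<inter> grad_vimage \<psi> B)"
      proof (intro ballI)
        fix A B :: "'a set" assume AB: "A \<in> sets punctured_borel" "B \<in> sets borel"
        then have "A \<times> B \<in> sets punctured_borel"
          using Times[of A B] by (auto simp: s\<gamma> sets_punctured_borel_iff)
        then show "emeasure (res (id_grad_push \<psi> \<mu>)) (A \<times> B) = emeasure \<mu> (A \<inter> grad_vimage \<psi> B)"
          by (simp add: res(1)[OF s(1)] id_push[OF AB])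
      qed
      show "\<forall>B\<in>sets borel. 0 \<notin> closure B \<longrightarrow>
          emeasure (res (id_grad_push \<psi> \<mu>)) ({0} \<times> B) = emeasure \<nu> B - emeasure (grad_push \<psi> \<mu>) B"
      proof (intro ballI impI)
        fix B :: "'a set" assume B: "B \<in> sets borel" "0 \<notin> closure B"
        then have "{0 :: 'a} \<times> B \<in> sets punctured_borel"
          using Times[of "{0}" B] far[OF B] by (auto simp: s\<gamma> sets_punctured_borel_iff)
        then have "emeasure (res (id_grad_push \<psi> \<mu>)) ({0} \<times> B) = 0"
          using emeasure_id_grad_push_Times[OF \<psi> \<mu>, of "{0}" B] B by (simp add: res(1)[OF s(1)])
        then show "emeasure (res (id_grad_push \<psi> \<mu>)) ({0} \<times> B) = emeasure \<nu> B - emeasure (grad_push \<psi> \<mu>) B"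
          using fibre[OF B] zero[OF far[OF B]] by simp
      qed
    qed
    moreover have "\<nu> = res (grad_push \<psi> \<mu>)"
    proof (rule measure_eqI)
      show "sets \<nu> = sets (res (grad_push \<psi> \<mu>))"
        using \<nu> res(2)[OF s(2) sets.empty_sets] by simp
      show "emeasure \<nu> B = emeasure (res (grad_push \<psi> \<mu>)) B" if "B \<in> sets \<nu>" for B
        using that first[of B] zero[of B] res(1)[OF s(2), of B] \<nu> by simp
    qed
    ultimately show ?thesis by simp
  qed
  show ?thesis
    by (intro conjI ballI allI impI)
       ((rule null) | (rule first id_eq id_push fibre conjunct1[OF proper] conjunct2[OF proper]; assumption)
        | (elim conjE, rule unique; assumption))+
qed

end
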